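(* Assume: (1) $\mathcal H=\bigoplus_{n\ge0}\mathcal H_n$ is a graded connected Hopf algebra over $\mathbb R$, each $\mathcal H_n$ finite-dimensional with basis $\mathcal B_n$, and $\mathcal B=\coprod_n\mathcal B_n$; (2) $\tau:\mathcal B\to\mathcal B$ is a graded involution whose linear extension is a Hopf ambimorphism of $\mathcal H$; (3) $n$ is fixed and $P$ is a probability distribution on signed weak-compositions of $n$, or on tilde-signed weak-compositions of $n$ (not a mixture), and $m\circ\Delta_{P(\tau)}:=\sum_D\frac{P(D)}{\binom{n}{D^+}}m\circ\Delta_{D(\tau)}$; (4) for each $D=(d_1,\dots,d_l)$ with $P(D)>0$, all $x\in\mathcal B_n$ and all $z_i\in\mathcal B_{|d_i|}$: $z_1\cdots z_l=\sum_{y\in\mathcal B_n}\xi^y_{z_1,\dots,z_l}y$ with all $\xi^y_{z_1,\dots,z_l}\ge0$, and $\Delta_{D^+}(x)=\sum\eta_x^{z_1,\dots,z_l}z_1\otimes\cdots\otimes z_l$ with all $\eta_x^{z_1,\dots,z_l}\ge0$; (5) $\eta(x)>0$ for all $x\in\mathcal B_n$. Then the matrix $$K(x,y):=\frac{\eta(y)}{\eta(x)}\cdot\big(\text{coefficient of }y\text{ in }m\circ\Delta_{P(\tau)}(x)\big),\qquad x,y\in\mathcal B_n,$$ is a transition matrix (nonnegative with rows summing to $1$), and $K(x,y)$ equals the probability that the following process, started at $x$, produces $y$: 1. Choose $D$ according to $P$. 2. Choose $z_1\in\mathcal B_{|d_1|},\dots,z_l\in\mathcal B_{|d_l|}$ with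 probability $\frac{1}{\eta(x)}\eta_x^{z_1,\dots,z_l}\eta(z_1)\cdots\eta(z_l)$. 3. For each $i$ with $d_i$ decorated, replace $z_i$ by $\tau(z_i)$; call the results $z'_1,\dots,z'_l$. 4. Choose $y\in\mathcal B_n$ with probability $\big(\binom{n}{D^+}\eta(z_1)\cdots\eta(z_l)\big)^{-1}\xi^y_{z'_1,\dots,z'_l}\eta(y)$.
   Context: Graded connected Hopf algebra: $\mathcal H_0=\mathbb R\cdot1$, product $m$ (iterated products also denoted $m$), coproduct $\Delta$; $\Delta^{[l]}$ iterated coproduct; for a weak-composition $E=(e_1,\dots,e_l)$ of $n$ (nonnegative integers summing to $n$), $\Delta_E$ is $\Delta^{[l]}$ on $\mathcal H_n$ projected to $\mathcal H_{e_1}\otimes\cdots\otimes\mathcal H_{e_l}$. A Hopf ambimorphism is a linear map that is an algebra morphism or antimorphism and a coalgebra morphism or antimorphism. A signed (resp. tilde-signed) weak-composition is a weak-composition with some parts decorated by a bar (resp. tilde-bar); $D^+=(|d_1|,\dots,|d_l|)$ forgets decorations; $\binom{n}{D^+}$ is the multinomial coefficient. $m\circ\Delta_{D(\tau)}$: apply $\Delta_{D^+}$, then $\tau$ on tensor factors corresponding to decorated parts, then multiply. For a basis element $x$ of any degree $j$, $\eta(x)$ is the sum of the coefficients of $\Delta_{1,\dots,1}(x)$ (with $j$ ones) in the basis $\mathcal B_1\otimes\cdots\otimes\mathcal B_1$ (with $\eta=1$ on $\mathcal B_0=\{1\}$). *)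

theory Defs
  imports "HOL-Probability.Probability" "HOL-Library.Poly_Mapping"
begin

section \<open>The tensor algebra of a real vector space\<close>

instantiation poly_mapping :: (type, real_vector) real_vector
begin

lift_definition scaleR_poly_mapping :: "real \<Rightarrow> ('a \<Rightarrow>\<^sub>0 'b) \<Rightarrow> ('a \<Rightarrow>\<^sub>0 'b)"
  is "\<lambda>c f x. c *\<^sub>R f x"
  by (rule finite_subset) auto

instance
  by standard (transfer; simp add: fun_eq_iff scaleR_add_right scaleR_add_left)+

end

lemma lookup_scaleR [simp]: "Poly_Mapping.lookup (c *\<^sub>R p) k = c *\<^sub>R Poly_Mapping.lookup p k"
  by transfer simp

definition multilinear_relations :: "('a::real_vector list \<Rightarrow>\<^sub>0 real) set" where
  "multilinear_relations =
     {Poly_Mapping.single (us @ (a *\<^sub>R x + b *\<^sub>R y) # vs) 1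
        - a *\<^sub>R Poly_Mapping.single (us @ x # vs) 1
        - b *\<^sub>R Poly_Mapping.single (us @ y # vs) 1 | us vs a b x y. True}"

definition tensor_eq :: "('a::real_vector list \<Rightarrow>\<^sub>0 real) \<Rightarrow> ('a list \<Rightarrow>\<^sub>0 real) \<Rightarrow> bool" where
  "tensor_eq p q \<longleftrightarrow> p - q \<in> span multilinear_relations"

text \<open>
  The type \<open>'a tensor\<close> is the direct sum of all tensor powers of \<open>'a\<close>: the free vector space on
  finite lists, modulo linearity in each list entry.
\<close>

quotient_type (overloaded) 'a tensor = "'a::real_vector list \<Rightarrow>\<^sub>0 real" / tensor_eq
proof (rule equivpI)
  show "reflp (tensor_eq :: ('a list \<Rightarrow>\<^sub>0 real) \<Rightarrow> _)"
    by (simp add: reflp_def tensor_eq_def span_zero)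
  show "symp (tensor_eq :: ('a list \<Rightarrow>\<^sub>0 real) \<Rightarrow> _)"
    unfolding symp_def tensor_eq_def by (auto dest: span_neg)
  show "transp (tensor_eq :: ('a list \<Rightarrow>\<^sub>0 real) \<Rightarrow> _)"
  proof (rule transpI)
    fix p q r :: "'a list \<Rightarrow>\<^sub>0 real"
    assume "tensor_eq p q" "tensor_eq q r"
    then have "(p - q) + (q - r) \<in> span multilinear_relations"
      unfolding tensor_eq_def by (rule span_add)
    then show "tensor_eq p r" by (simp add: tensor_eq_def)
  qed
qed

instantiation tensor :: (real_vector) real_vector
begin

lift_definition zero_tensor :: "'a tensor" is 0 .

lift_definition plus_tensor :: "'a tensor \<Rightarrow> 'a tensor \<Rightarrow> 'a tensor" is "(+)"
  unfolding tensor_eq_def by (simp only: add_diff_add span_add)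

lift_definition uminus_tensor :: "'a tensor \<Rightarrow> 'a tensor" is uminus
  unfolding tensor_eq_def by (simp only: minus_diff_minus span_neg)

lift_definition minus_tensor :: "'a tensor \<Rightarrow> 'a tensor \<Rightarrow> 'a tensor" is "(-)"
proof -
  fix p p' q q' :: "'a list \<Rightarrow>\<^sub>0 real"
  assume "tensor_eq p p'" "tensor_eq q q'"
  moreover have "p - q - (p' - q') = (p - p') - (q - q')" by simp
  ultimately show "tensor_eq (p - q) (p' - q')"
    unfolding tensor_eq_def by (simp only: span_diff)
qed

lift_definition scaleR_tensor :: "real \<Rightarrow> 'a tensor \<Rightarrow> 'a tensor" is scaleR
  unfolding tensor_eq_def by (simp only: scaleR_diff_right[symmetric] span_scale)

instance
  by standard
    (transfer; simp add: tensor_eq_def span_zero scaleR_add_right scaleR_add_left algebra_simps)+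

end

lift_definition pure_tensor :: "'a::real_vector list \<Rightarrow> 'a tensor"
  is "\<lambda>xs. Poly_Mapping.single xs 1" .

definition multilinear :: "('a::real_vector list \<Rightarrow> 'b::real_vector) \<Rightarrow> bool" where
  "multilinear f \<longleftrightarrow> (\<forall>us vs. linear (\<lambda>x. f (us @ x # vs)))"

text \<open>
  The linear map on tensors induced by a multilinear \<open>f\<close>.  It is meaningful only if \<open>f\<close> is
  multilinear on lists of every length, hence the value 0 below on lists of the wrong length.
\<close>

definition tensor_lift :: "('a::real_vector list \<Rightarrow> 'b::real_vector) \<Rightarrow> 'a tensor \<Rightarrow> 'b" where
  "tensor_lift f t =
     (\<Sum>xs\<in>Poly_Mapping.keys (rep_tensor t). Poly_Mapping.lookup (rep_tensor t) xs *\<^sub>R f xs)"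

lemma tensor_lift_abs:
  assumes f: "multilinear f"
  shows "tensor_lift f (abs_tensor p)
       = (\<Sum>xs\<in>Poly_Mapping.keys p. Poly_Mapping.lookup p xs *\<^sub>R f xs)"
proof -
  define F where "F p = (\<Sum>xs\<in>Poly_Mapping.keys p. Poly_Mapping.lookup p xs *\<^sub>R f xs)" for p
  have F_superset: "F p = (\<Sum>xs\<in>A. Poly_Mapping.lookup p xs *\<^sub>R f xs)"
    if "finite A" "Poly_Mapping.keys p \<subseteq> A" for p A
    unfolding F_def using that
    by (intro sum.mono_neutral_left) (auto simp: in_keys_iff)
  have F_linear: "linear F"
  proof (rule linearI)
    fix p q :: "'a list \<Rightarrow>\<^sub>0 real" and c :: real
    let ?A = "Poly_Mapping.keys p \<union> Poly_Mapping.keys q"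
    have "Poly_Mapping.keys (p + q) \<subseteq> ?A" by (rule Poly_Mapping.keys_add)
    then show "F (p + q) = F p + F q"
      by (simp add: F_superset[of ?A] lookup_add scaleR_add_left sum.distrib)
    have "Poly_Mapping.keys (c *\<^sub>R p) \<subseteq> Poly_Mapping.keys p"
      by (auto simp: in_keys_iff)
    then have "F (c *\<^sub>R p) = (\<Sum>xs\<in>Poly_Mapping.keys p. Poly_Mapping.lookup (c *\<^sub>R p) xs *\<^sub>R f xs)"
      by (intro F_superset) auto
    then show "F (c *\<^sub>R p) = c *\<^sub>R F p"
      by (simp add: F_def scaleR_sum_right)
  qed
  have F_single: "F (Poly_Mapping.single xs 1) = f xs" for xs
    by (simp add: F_def)
  have F_rel: "F r = 0" if rel: "r \<in> multilinear_relations" for r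
  proof -
    obtain us vs a b x y where r: "r =
        Poly_Mapping.single (us @ (a *\<^sub>R x + b *\<^sub>R y) # vs) 1
        - a *\<^sub>R Poly_Mapping.single (us @ x # vs) 1
        - b *\<^sub>R Poly_Mapping.single (us @ y # vs) 1"
      using rel unfolding multilinear_relations_def by blast
    have "linear (\<lambda>x. f (us @ x # vs))"
      using f by (simp add: multilinear_def)
    then have "f (us @ (a *\<^sub>R x + b *\<^sub>R y) # vs) = a *\<^sub>R f (us @ x # vs) + b *\<^sub>R f (us @ y # vs)"
      using linear_add[of "\<lambda>x. f (us @ x # vs)"] linear_scale[of "\<lambda>x. f (us @ x # vs)"] by simp
    then show ?thesis
      unfolding r by (simp add: linear_diff[OF F_linear] linear_scale[OF F_linear] F_single)
  qed
  have F_span: "F r = 0" if "r \<in> span multilinear_relations" for r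
    using F_linear F_rel that by (rule linear_eq_0_on_span)
  have "tensor_eq (rep_tensor (abs_tensor p)) p"
    by (rule Quotient3_rep_abs[OF Quotient3_tensor]) (simp add: tensor_eq_def span_zero)
  then have "F (rep_tensor (abs_tensor p) - p) = 0"
    unfolding tensor_eq_def by (rule F_span)
  then have "F (rep_tensor (abs_tensor p)) = F p"
    by (simp add: linear_diff[OF F_linear])
  then show ?thesis
    by (simp add: tensor_lift_def F_def)
qed

lemma tensor_lift_pure: "multilinear f \<Longrightarrow> tensor_lift f (pure_tensor xs) = f xs"
  by (simp add: pure_tensor.abs_eq tensor_lift_abs)

text \<open>
  The concatenation product of tensors, and the tensor product \<open>f\<^sub>1 \<otimes> \<dots> \<otimes> f\<^sub>l\<close> of linear maps
  \<open>f\<^sub>i\<close> into tensor powers; a map into \<open>'b\<close> itself is composed with \<open>tensor_of\<close>.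
\<close>

definition tensor_concat :: "'a::real_vector tensor \<Rightarrow> 'a tensor \<Rightarrow> 'a tensor" where
  "tensor_concat s t = tensor_lift (\<lambda>xs. tensor_lift (\<lambda>ys. pure_tensor (xs @ ys)) t) s"

definition tensor_of :: "'a::real_vector \<Rightarrow> 'a tensor" where
  "tensor_of x = pure_tensor [x]"

definition tensor_maps ::
    "('a::real_vector \<Rightarrow> 'b::real_vector tensor) list \<Rightarrow> 'a tensor \<Rightarrow> 'b tensor" where
  "tensor_maps fs = tensor_lift (\<lambda>xs.
     if length xs = length fs
     then foldr tensor_concat (map2 (\<lambda>f x. f x) fs xs) (pure_tensor [])
     else 0)"

definition tensor_times :: "'a::real_algebra tensor \<Rightarrow> 'a tensor \<Rightarrow> 'a tensor" where
  "tensor_times s t = tensor_lift (\<lambda>xs. tensor_lift (\<lambda>ys.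
     if length xs = length ys then pure_tensor (map2 (*) xs ys) else 0) t) s"

definition tensor_rev :: "'a::real_vector tensor \<Rightarrow> 'a tensor" where
  "tensor_rev = tensor_lift (\<lambda>xs. pure_tensor (rev xs))"

definition tensor_mult :: "'a::real_algebra_1 tensor \<Rightarrow> 'a" where
  "tensor_mult = tensor_lift prod_list"

section \<open>Graded connected Hopf algebras\<close>

definition graded_vector_space :: "(nat \<Rightarrow> 'h::real_vector set) \<Rightarrow> bool" where
  "graded_vector_space H \<longleftrightarrow>
     (\<forall>n. subspace (H n)) \<and> span (\<Union>n. H n) = UNIV \<and>
     (\<forall>n. H n \<inter> span (\<Union>k\<in>- {n}. H k) = {0})"

definition graded_proj :: "(nat \<Rightarrow> 'h::real_vector set) \<Rightarrow> nat \<Rightarrow> 'h \<Rightarrow> 'h" where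
  "graded_proj H n v = (THE u. u \<in> H n \<and> v - u \<in> span (\<Union>k\<in>- {n}. H k))"

text \<open>A linear functional, viewed as a map into the 0th tensor power.\<close>

definition scalar_tensor :: "('h::real_vector \<Rightarrow> real) \<Rightarrow> 'h \<Rightarrow> 'h tensor" where
  "scalar_tensor \<epsilon> x = \<epsilon> x *\<^sub>R pure_tensor []"

locale graded_connected_hopf_algebra =
  fixes H :: "nat \<Rightarrow> 'h::real_algebra_1 set"
    and \<Delta> :: "'h \<Rightarrow> 'h tensor"
    and \<epsilon> :: "'h \<Rightarrow> real"
  assumes graded: "graded_vector_space H"
    and connected: "H 0 = span {1}"
    and mult_graded: "x \<in> H i \<Longrightarrow> y \<in> H j \<Longrightarrow> x * y \<in> H (i + j)"
    and coprod_linear: "linear \<Delta>"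
    and coprod_graded:
      "x \<in> H n \<Longrightarrow> \<Delta> x \<in> span (\<Union>i\<le>n. {pure_tensor [u, v] | u v. u \<in> H i \<and> v \<in> H (n - i)})"
    and counit_linear: "linear \<epsilon>"
    and counit_graded: "x \<in> H n \<Longrightarrow> n > 0 \<Longrightarrow> \<epsilon> x = 0"
    and coassoc: "tensor_maps [\<Delta>, tensor_of] (\<Delta> x) = tensor_maps [tensor_of, \<Delta>] (\<Delta> x)"
    and counit_left: "tensor_maps [scalar_tensor \<epsilon>, tensor_of] (\<Delta> x) = tensor_of x"
    and counit_right: "tensor_maps [tensor_of, scalar_tensor \<epsilon>] (\<Delta> x) = tensor_of x"
    and coprod_mult: "\<Delta> (x * y) = tensor_times (\<Delta> x) (\<Delta> y)"
    and coprod_one: "\<Delta> 1 = pure_tensor [1, 1]"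
    and counit_mult: "\<epsilon> (x * y) = \<epsilon> x * \<epsilon> y"
    and counit_one: "\<epsilon> 1 = 1"
    and antipode: "\<exists>S. linear S \<and>
      (\<forall>x. tensor_mult (tensor_maps [tensor_of \<circ> S, tensor_of] (\<Delta> x)) = \<epsilon> x *\<^sub>R 1) \<and>
      (\<forall>x. tensor_mult (tensor_maps [tensor_of, tensor_of \<circ> S] (\<Delta> x)) = \<epsilon> x *\<^sub>R 1)"

fun iterated_coprod ::
    "('h::real_vector \<Rightarrow> 'h tensor) \<Rightarrow> ('h \<Rightarrow> real) \<Rightarrow> nat \<Rightarrow> 'h \<Rightarrow> 'h tensor" where
  "iterated_coprod \<Delta> \<epsilon> 0 = scalar_tensor \<epsilon>"
| "iterated_coprod \<Delta> \<epsilon> (Suc 0) = tensor_of"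
| "iterated_coprod \<Delta> \<epsilon> (Suc (Suc l)) =
     (\<lambda>x. tensor_maps [tensor_of, iterated_coprod \<Delta> \<epsilon> (Suc l)] (\<Delta> x))"

definition coprod_comp ::
    "(nat \<Rightarrow> 'h::real_vector set) \<Rightarrow> ('h \<Rightarrow> 'h tensor) \<Rightarrow> ('h \<Rightarrow> real) \<Rightarrow> nat list \<Rightarrow> 'h \<Rightarrow> 'h tensor"
  where
  "coprod_comp H \<Delta> \<epsilon> E x =
     tensor_maps (map (\<lambda>e. tensor_of \<circ> graded_proj H e) E) (iterated_coprod \<Delta> \<epsilon> (length E) x)"

definition algebra_morphism :: "('h::real_algebra_1 \<Rightarrow> 'h) \<Rightarrow> bool" where
  "algebra_morphism f \<longleftrightarrow> linear f \<and> f 1 = 1 \<and> (\<forall>x y. f (x * y) = f x * f y)"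

definition algebra_antimorphism :: "('h::real_algebra_1 \<Rightarrow> 'h) \<Rightarrow> bool" where
  "algebra_antimorphism f \<longleftrightarrow> linear f \<and> f 1 = 1 \<and> (\<forall>x y. f (x * y) = f y * f x)"

definition coalgebra_morphism ::
    "('h::real_vector \<Rightarrow> 'h tensor) \<Rightarrow> ('h \<Rightarrow> real) \<Rightarrow> ('h \<Rightarrow> 'h) \<Rightarrow> bool" where
  "coalgebra_morphism \<Delta> \<epsilon> f \<longleftrightarrow> linear f \<and> (\<forall>x. \<epsilon> (f x) = \<epsilon> x) \<and>
     (\<forall>x. \<Delta> (f x) = tensor_maps [tensor_of \<circ> f, tensor_of \<circ> f] (\<Delta> x))"

definition coalgebra_antimorphism ::
    "('h::real_vector \<Rightarrow> 'h tensor) \<Rightarrow> ('h \<Rightarrow> real) \<Rightarrow> ('h \<Rightarrow> 'h) \<Rightarrow> bool" where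
  "coalgebra_antimorphism \<Delta> \<epsilon> f \<longleftrightarrow> linear f \<and> (\<forall>x. \<epsilon> (f x) = \<epsilon> x) \<and>
     (\<forall>x. \<Delta> (f x) = tensor_rev (tensor_maps [tensor_of \<circ> f, tensor_of \<circ> f] (\<Delta> x)))"

definition hopf_ambimorphism ::
    "('h::real_algebra_1 \<Rightarrow> 'h tensor) \<Rightarrow> ('h \<Rightarrow> real) \<Rightarrow> ('h \<Rightarrow> 'h) \<Rightarrow> bool" where
  "hopf_ambimorphism \<Delta> \<epsilon> f \<longleftrightarrow>
     (algebra_morphism f \<or> algebra_antimorphism f) \<and>
     (coalgebra_morphism \<Delta> \<epsilon> f \<or> coalgebra_antimorphism \<Delta> \<epsilon> f)"

definition linear_ext :: "(nat \<Rightarrow> 'h::real_vector set) \<Rightarrow> ('h \<Rightarrow> 'h) \<Rightarrow> 'h \<Rightarrow> 'h" where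
  "linear_ext B \<tau> = construct (\<Union>n. B n) \<tau>"

section \<open>Structure constants\<close>

definition mult_coeff :: "(nat \<Rightarrow> 'h::real_algebra_1 set) \<Rightarrow> nat \<Rightarrow> 'h list \<Rightarrow> 'h \<Rightarrow> real" where
  "mult_coeff B n zs y = representation (B n) (prod_list zs) y"

definition comult_coeff ::
    "(nat \<Rightarrow> 'h::real_vector set) \<Rightarrow> ('h \<Rightarrow> 'h tensor) \<Rightarrow> ('h \<Rightarrow> real) \<Rightarrow> (nat \<Rightarrow> 'h set) \<Rightarrow>
     nat list \<Rightarrow> 'h \<Rightarrow> 'h list \<Rightarrow> real" where
  "comult_coeff H \<Delta> \<epsilon> B E x zs =
     representation (pure_tensor ` listset (map B E)) (coprod_comp H \<Delta> \<epsilon> E x) (pure_tensor zs)"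

text \<open>The argument \<open>j\<close> is the degree of the basis element \<open>x\<close>.\<close>

definition eta ::
    "(nat \<Rightarrow> 'h::real_vector set) \<Rightarrow> ('h \<Rightarrow> 'h tensor) \<Rightarrow> ('h \<Rightarrow> real) \<Rightarrow> (nat \<Rightarrow> 'h set) \<Rightarrow>
     nat \<Rightarrow> 'h \<Rightarrow> real" where
  "eta H \<Delta> \<epsilon> B j x =
     (if j = 0 then 1
      else \<Sum>zs\<in>listset (replicate j (B 1)). comult_coeff H \<Delta> \<epsilon> B (replicate j 1) x zs)"

definition eta_prod ::
    "(nat \<Rightarrow> 'h::real_vector set) \<Rightarrow> ('h \<Rightarrow> 'h tensor) \<Rightarrow> ('h \<Rightarrow> real) \<Rightarrow> (nat \<Rightarrow> 'h set) \<Rightarrow>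
     nat list \<Rightarrow> 'h list \<Rightarrow> real" where
  "eta_prod H \<Delta> \<epsilon> B E zs = prod_list (map2 (eta H \<Delta> \<epsilon> B) E zs)"

section \<open>Decorated weak-compositions and the associated operators\<close>

datatype decoration = Plain | Bar | Tilde_Bar

type_synonym decorated_composition = "(nat \<times> decoration) list"

abbreviation forget :: "decorated_composition \<Rightarrow> nat list" where
  "forget \<equiv> map fst"

definition signed_weak_compositions :: "nat \<Rightarrow> decorated_composition set" where
  "signed_weak_compositions n = {D. sum_list (forget D) = n \<and> Tilde_Bar \<notin> set (map snd D)}"

definition tilde_signed_weak_compositions :: "nat \<Rightarrow> decorated_composition set" where
  "tilde_signed_weak_compositions n = {D. sum_list (forget D) = n \<and> Bar \<notin> set (map snd D)}"

definition multinomial :: "nat list \<Rightarrow> real" where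
  "multinomial E = fact (sum_list E) / prod_list (map fact E)"

definition decorated_maps :: "('h \<Rightarrow> 'h) \<Rightarrow> decorated_composition \<Rightarrow> ('h \<Rightarrow> 'h) list" where
  "decorated_maps f D = map (\<lambda>(d, c). if c = Plain then id else f) D"

text \<open>The operator \<open>m \<circ> \<Delta>\<^bsub>D(f)\<^esub>\<close>, for \<open>f\<close> a linear map.\<close>

definition mult_comult ::
    "(nat \<Rightarrow> 'h::real_algebra_1 set) \<Rightarrow> ('h \<Rightarrow> 'h tensor) \<Rightarrow> ('h \<Rightarrow> real) \<Rightarrow>
     ('h \<Rightarrow> 'h) \<Rightarrow> decorated_composition \<Rightarrow> 'h \<Rightarrow> 'h" where
  "mult_comult H \<Delta> \<epsilon> f D x =
     tensor_mult (tensor_maps (map ((\<circ>) tensor_of) (decorated_maps f D))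
       (coprod_comp H \<Delta> \<epsilon> (forget D) x))"

text \<open>
  The operator \<open>m \<circ> \<Delta>\<^bsub>P(f)\<^esub>\<close> on the degree \<open>n\<close> part.  A number has infinitely many
  weak-compositions, so the sum over \<open>D\<close> is an infinite one in a finite-dimensional space; it is
  taken coordinatewise.
\<close>

definition mult_comult_dist ::
    "(nat \<Rightarrow> 'h::real_algebra_1 set) \<Rightarrow> ('h \<Rightarrow> 'h tensor) \<Rightarrow> ('h \<Rightarrow> real) \<Rightarrow> (nat \<Rightarrow> 'h set) \<Rightarrow>
     ('h \<Rightarrow> 'h) \<Rightarrow> nat \<Rightarrow> decorated_composition pmf \<Rightarrow> 'h \<Rightarrow> 'h" where
  "mult_comult_dist H \<Delta> \<epsilon> B f n P x =
     (\<Sum>y\<in>B n. (\<Sum>\<^sub>\<infinity>D. pmf P D / multinomial (forget D) *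
        representation (B n) (mult_comult H \<Delta> \<epsilon> f D x) y) *\<^sub>R y)"

definition transition ::
    "(nat \<Rightarrow> 'h::real_algebra_1 set) \<Rightarrow> ('h \<Rightarrow> 'h tensor) \<Rightarrow> ('h \<Rightarrow> real) \<Rightarrow> (nat \<Rightarrow> 'h set) \<Rightarrow>
     ('h \<Rightarrow> 'h) \<Rightarrow> nat \<Rightarrow> decorated_composition pmf \<Rightarrow> 'h \<Rightarrow> 'h \<Rightarrow> real" where
  "transition H \<Delta> \<epsilon> B \<tau> n P x y =
     eta H \<Delta> \<epsilon> B n y / eta H \<Delta> \<epsilon> B n x *
     representation (B n) (mult_comult_dist H \<Delta> \<epsilon> B (linear_ext B \<tau>) n P x) y"

section \<open>The random process\<close>

definition split_prob ::
    "(nat \<Rightarrow> 'h::real_algebra_1 set) \<Rightarrow> ('h \<Rightarrow> 'h tensor) \<Rightarrow> ('h \<Rightarrow> real) \<Rightarrow> (nat \<Rightarrow> 'h set) \<Rightarrow>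
     nat \<Rightarrow> decorated_composition \<Rightarrow> 'h \<Rightarrow> 'h list \<Rightarrow> real" where
  "split_prob H \<Delta> \<epsilon> B n D x zs =
     (if zs \<in> listset (map B (forget D))
      then 1 / eta H \<Delta> \<epsilon> B n x * comult_coeff H \<Delta> \<epsilon> B (forget D) x zs *
           eta_prod H \<Delta> \<epsilon> B (forget D) zs
      else 0)"

definition apply_decorations :: "('h \<Rightarrow> 'h) \<Rightarrow> decorated_composition \<Rightarrow> 'h list \<Rightarrow> 'h list" where
  "apply_decorations \<tau> D zs = map2 (\<lambda>g z. g z) (decorated_maps \<tau> D) zs"

definition merge_prob ::
    "(nat \<Rightarrow> 'h::real_algebra_1 set) \<Rightarrow> ('h \<Rightarrow> 'h tensor) \<Rightarrow> ('h \<Rightarrow> real) \<Rightarrow> (nat \<Rightarrow> 'h set) \<Rightarrow>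
     ('h \<Rightarrow> 'h) \<Rightarrow> nat \<Rightarrow> decorated_composition \<Rightarrow> 'h list \<Rightarrow> 'h \<Rightarrow> real" where
  "merge_prob H \<Delta> \<epsilon> B \<tau> n D zs y =
     (if y \<in> B n
      then inverse (multinomial (forget D) * eta_prod H \<Delta> \<epsilon> B (forget D) zs) *
           mult_coeff B n (apply_decorations \<tau> D zs) y * eta H \<Delta> \<epsilon> B n y
      else 0)"

text \<open>
  \<open>embed_pmf\<close> is meaningful only on functions that are nonnegative with total mass 1; for
  \<open>merge_prob\<close> this is to be expected only for those \<open>zs\<close> that \<open>split_prob\<close> gives positive mass.
\<close>

definition hopf_process ::
    "(nat \<Rightarrow> 'h::real_algebra_1 set) \<Rightarrow> ('h \<Rightarrow> 'h tensor) \<Rightarrow> ('h \<Rightarrow> real) \<Rightarrow> (nat \<Rightarrow> 'h set) \<Rightarrow>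
     ('h \<Rightarrow> 'h) \<Rightarrow> nat \<Rightarrow> decorated_composition pmf \<Rightarrow> 'h \<Rightarrow> 'h pmf" where
  "hopf_process H \<Delta> \<epsilon> B \<tau> n P x =
     bind_pmf P (\<lambda>D.
     bind_pmf (embed_pmf (split_prob H \<Delta> \<epsilon> B n D x)) (\<lambda>zs.
     embed_pmf (merge_prob H \<Delta> \<epsilon> B \<tau> n D zs)))"

end

theory Submission
  imports Defs
begin

text \<open>
  Let \<open>\<zeta>\<close> be the linear functional that is 1 on \<open>B 1\<close> and 0 on all other basis elements.  Then
  \<open>\<eta>\<close> in degree \<open>j\<close> is the \<open>j\<close>-th convolution power of \<open>\<zeta>\<close>.  Coassociativity gives
  \<open>\<Sum> \<eta>\<^sub>x\<^sup>z \<eta>(z\<^sub>1) \<cdots> \<eta>(z\<^sub>l) = \<eta>(x)\<close>, so the splitting step has total mass 1.  Since \<open>\<zeta>\<close> lives in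
  degree 1 it is a derivation relative to the counit, so its powers obey the binomial theorem and
  \<open>\<eta>(z\<^sub>1 \<cdots> z\<^sub>l)\<close> is the multinomial coefficient times \<open>\<eta>(z\<^sub>1) \<cdots> \<eta>(z\<^sub>l)\<close>: the merging step has total
  mass 1.  Finally \<open>\<tau>\<close> permutes \<open>B 1\<close>, so \<open>\<zeta> \<circ> \<tau> = \<zeta>\<close>, and \<open>\<tau>\<close> preserves \<open>\<eta>\<close>; if \<open>\<tau>\<close> reverses the
  coproduct this still holds because powers of \<open>\<zeta>\<close> commute.  Nonnegativity of
  \<open>\<eta>(z\<^sub>1) \<cdots> \<eta>(z\<^sub>l)\<close> is read off from the merging identity, as only \<open>\<eta>\<close> in degree \<open>n\<close> is known to be
  positive; where this weight vanishes, that identity makes every coefficient of the product vanish,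
  so no mass is lost when it cancels between the two steps.
\<close>

section \<open>Linear and bilinear maps\<close>

lemma linear_image_in_span:
  assumes "linear f" "v \<in> span S" "\<And>s. s \<in> S \<Longrightarrow> f s \<in> span T"
  shows "f v \<in> span T"
proof -
  have "f v \<in> span (f ` S)"
    using assms(1,2) by (simp add: linear_span_image)
  also have "\<dots> \<subseteq> span T"
    using assms(3) by (intro span_minimal subspace_span) auto
  finally show ?thesis .
qed

lemma representation_sum_scaleR:
  assumes "independent S" "finite S" "b \<in> S"
  shows "representation S (\<Sum>y\<in>S. c y *\<^sub>R y) b = c b"
proof -
  have "representation S (\<Sum>y\<in>S. c y *\<^sub>R y) b = (\<Sum>y\<in>S. representation S (c y *\<^sub>R y) b)"
    using assms(1) by (subst representation_sum) (auto intro: span_scale span_base)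
  also have "\<dots> = (\<Sum>y\<in>S. if y = b then c y else 0)"
    by (rule sum.cong)
      (auto simp: representation_scale[OF assms(1) span_base] representation_basis[OF assms(1)])
  finally show ?thesis using assms by simp
qed

lemma linear_bilinear_left: "bilinear f \<Longrightarrow> linear (\<lambda>x. f x y)"
  and linear_bilinear_right: "bilinear f \<Longrightarrow> linear (f x)"
  by (simp_all add: bilinear_def)

lemma bilinear_compose_linear: "bilinear f \<Longrightarrow> linear g \<Longrightarrow> bilinear (\<lambda>x y. g (f x y))"
  by (simp add: bilinear_def linear_iff)

lemma bilinear_linear_arguments:
  "bilinear f \<Longrightarrow> linear g \<Longrightarrow> linear h \<Longrightarrow> bilinear (\<lambda>x y. f (g x) (h y))"
  by (simp add: bilinear_def linear_iff)

section \<open>Linear maps on tensors\<close>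

lemma pure_tensor_combination:
  "pure_tensor (us @ (a *\<^sub>R x + b *\<^sub>R y) # vs)
     = a *\<^sub>R pure_tensor (us @ x # vs) + b *\<^sub>R pure_tensor (us @ y # vs)"
proof (transfer fixing: us a x b y vs)
  have "Poly_Mapping.single (us @ (a *\<^sub>R x + b *\<^sub>R y) # vs) 1
        - a *\<^sub>R Poly_Mapping.single (us @ x # vs) 1
        - b *\<^sub>R Poly_Mapping.single (us @ y # vs) (1::real) \<in> span multilinear_relations"
    by (rule span_base) (simp only: multilinear_relations_def, blast)
  then show "tensor_eq (Poly_Mapping.single (us @ (a *\<^sub>R x + b *\<^sub>R y) # vs) 1)
      (a *\<^sub>R Poly_Mapping.single (us @ x # vs) 1 + b *\<^sub>R Poly_Mapping.single (us @ y # vs) 1)"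
    by (simp add: tensor_eq_def diff_diff_eq)
qed

lemma multilinear_pure_tensor: "multilinear pure_tensor"
  unfolding multilinear_def
proof (intro allI linearI)
  fix us vs :: "'a list" and x y :: 'a and c :: real
  show "pure_tensor (us @ (x + y) # vs) = pure_tensor (us @ x # vs) + pure_tensor (us @ y # vs)"
    using pure_tensor_combination[of us 1 x 1 y vs] by simp
  show "pure_tensor (us @ (c *\<^sub>R x) # vs) = c *\<^sub>R pure_tensor (us @ x # vs)"
    using pure_tensor_combination[of us c x 0 x vs] by simp
qed

lemma tensor_in_span_pure: "t \<in> span (range pure_tensor)"
proof (induction t rule: tensor.abs_induct)
  case (1 p)
  show ?case
  proof (induction p rule: update_induct)
    case const
    show ?case by (simp add: zero_tensor.abs_eq[symmetric] span_zero)
  next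
    case (update p xs c)
    then have "Poly_Mapping.update xs c p = p + c *\<^sub>R Poly_Mapping.single xs 1"
      by (intro poly_mapping_eqI)
        (auto simp: lookup_update lookup_add lookup_single when_def in_keys_iff)
    then have "abs_tensor (Poly_Mapping.update xs c p) = abs_tensor p + c *\<^sub>R pure_tensor xs"
      by (simp add: plus_tensor.abs_eq scaleR_tensor.abs_eq pure_tensor.abs_eq)
    with update.IH show ?case by (simp add: span_add span_scale span_base)
  qed
qed

lemma tensor_induct [case_names pure add scale]:
  assumes pure: "\<And>xs. Q (pure_tensor xs)"
    and add: "\<And>s t. Q s \<Longrightarrow> Q t \<Longrightarrow> Q (s + t)"
    and scale: "\<And>c t. Q t \<Longrightarrow> Q (c *\<^sub>R t)"
  shows "Q t"
proof (rule span_induct_alt[OF tensor_in_span_pure[of t]])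
  show "Q 0" using scale[of "pure_tensor []" 0] pure by simp
qed (use assms in auto)

lemma linear_tensor_eqI:
  assumes "linear f" "linear g" "\<And>xs. f (pure_tensor xs) = g (pure_tensor xs)"
  shows "f t = g t"
  by (rule linear_eq_on_span[OF assms(1,2) _ tensor_in_span_pure]) (use assms(3) in auto)

lemma bilinear_tensor_eqI:
  assumes "bilinear f" "bilinear g"
    and "\<And>xs ys. f (pure_tensor xs) (pure_tensor ys) = g (pure_tensor xs) (pure_tensor ys)"
  shows "f s t = g s t"
  by (rule bilinear_eq[OF assms(1,2), of UNIV "range pure_tensor" UNIV "range pure_tensor"])
    (use assms(3) tensor_in_span_pure in auto)

lemma linear_tensor_lift:
  assumes f: "multilinear f"
  shows "linear (tensor_lift f)"
proof -
  have lift_eq: "tensor_lift f (abs_tensor p) = (\<Sum>xs\<in>A. Poly_Mapping.lookup p xs *\<^sub>R f xs)"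
    if "finite A" "Poly_Mapping.keys p \<subseteq> A" for p A
    unfolding tensor_lift_abs[OF f] using that
    by (intro sum.mono_neutral_left) (auto simp: in_keys_iff)
  show ?thesis
  proof (rule linearI)
    fix s t :: "'a tensor" and c :: real
    obtain p q where pq: "s = abs_tensor p" "t = abs_tensor q"
      by (metis Quotient3_abs_rep[OF Quotient3_tensor])
    let ?A = "Poly_Mapping.keys p \<union> Poly_Mapping.keys q"
    have "Poly_Mapping.keys (p + q) \<subseteq> ?A" by (rule Poly_Mapping.keys_add)
    then show "tensor_lift f (s + t) = tensor_lift f s + tensor_lift f t"
      by (simp add: pq plus_tensor.abs_eq lift_eq[of ?A] lookup_add scaleR_add_left sum.distrib)
    have "Poly_Mapping.keys (c *\<^sub>R p) \<subseteq> Poly_Mapping.keys p"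
      by (auto simp: in_keys_iff)
    then show "tensor_lift f (c *\<^sub>R s) = c *\<^sub>R tensor_lift f s"
      by (simp add: pq scaleR_tensor.abs_eq lift_eq[of "Poly_Mapping.keys p"] scaleR_sum_right)
  qed
qed

lemma multilinear_ConsI:
  assumes "\<And>vs. linear (\<lambda>x. F (x # vs))" and "\<And>u. multilinear (\<lambda>xs. F (u # xs))"
  shows "multilinear F"
  unfolding multilinear_def
proof (intro allI)
  fix us vs
  show "linear (\<lambda>x. F (us @ x # vs))"
    using assms by (cases us) (auto simp: multilinear_def)
qed

lemma multilinear_zero: "multilinear (\<lambda>xs. 0)"
  by (simp add: multilinear_def linear_zero)

lemma multilinear_compose: "multilinear f \<Longrightarrow> linear g \<Longrightarrow> multilinear (\<lambda>xs. g (f xs))"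
  unfolding multilinear_def using linear_compose[unfolded o_def] by blast

lemma multilinear_tensor_lift_param:
  assumes "\<And>xs. multilinear (G xs)" "\<And>ys. multilinear (\<lambda>xs. G xs ys)"
  shows "multilinear (\<lambda>xs. tensor_lift (G xs) t)"
proof (induction t rule: tensor_induct)
  case (pure ys)
  show ?case using assms by (simp add: tensor_lift_pure)
next
  case (add s t)
  then show ?case
    by (simp add: linear_add[OF linear_tensor_lift[OF assms(1)]] multilinear_def linear_compose_add)
next
  case (scale c t)
  then show ?case
    by (simp add: linear_scale[OF linear_tensor_lift[OF assms(1)]] multilinear_def
        linear_compose_scale_right)
qed

lemma bilinear_tensor_lift:
  assumes "\<And>xs. multilinear (G xs)" "\<And>ys. multilinear (\<lambda>xs. G xs ys)"
  shows "bilinear (\<lambda>s t. tensor_lift (\<lambda>xs. tensor_lift (G xs) t) s)"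
proof -
  note linear_lift = linear_tensor_lift[OF multilinear_tensor_lift_param[OF assms]]
  have "linear (\<lambda>t. tensor_lift (\<lambda>xs. tensor_lift (G xs) t) s)" for s
  proof (induction s rule: tensor_induct)
    case (pure xs)
    show ?case
      using assms by (simp add: tensor_lift_pure multilinear_tensor_lift_param linear_tensor_lift)
  qed (simp_all add: linear_add[OF linear_lift] linear_scale[OF linear_lift]
      linear_compose_add linear_compose_scale_right)
  with linear_lift show ?thesis by (simp add: bilinear_def)
qed

lemma tensor_lift_lift_pure:
  assumes "\<And>xs. multilinear (G xs)" "\<And>ys. multilinear (\<lambda>xs. G xs ys)"
  shows "tensor_lift (\<lambda>xs. tensor_lift (G xs) (pure_tensor ys)) (pure_tensor xs) = G xs ys"
  using assms by (simp add: tensor_lift_pure multilinear_tensor_lift_param)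

subsection \<open>Concatenation and tensor products of linear maps\<close>

lemma multilinear_append_left: "multilinear (\<lambda>ys. pure_tensor (xs @ ys))"
  unfolding multilinear_def
  using multilinear_pure_tensor[unfolded multilinear_def, rule_format, of "xs @ _"] by simp

lemma multilinear_append_right: "multilinear (\<lambda>xs. pure_tensor (xs @ ys))"
  unfolding multilinear_def
  using multilinear_pure_tensor[unfolded multilinear_def, rule_format, of _ "_ @ ys"] by simp

lemma tensor_concat_pure: "tensor_concat (pure_tensor xs) (pure_tensor ys) = pure_tensor (xs @ ys)"
  by (simp add: tensor_concat_def tensor_lift_lift_pure multilinear_append_left
      multilinear_append_right)

lemma bilinear_tensor_concat: "bilinear tensor_concat"
  unfolding tensor_concat_def[abs_def]
  by (intro bilinear_tensor_lift multilinear_append_left multilinear_append_right)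

lemmas linear_tensor_concat_left = linear_bilinear_left[OF bilinear_tensor_concat]
lemmas linear_tensor_concat_right = linear_bilinear_right[OF bilinear_tensor_concat]

lemma tensor_concat_Nil_right: "tensor_concat t (pure_tensor []) = t"
  by (rule linear_tensor_eqI[OF linear_tensor_concat_left linear_id[unfolded id_def]])
    (simp add: tensor_concat_pure)

lemma linear_tensor_of: "linear tensor_of"
  using multilinear_pure_tensor[unfolded multilinear_def, rule_format, of "[]" "[]"]
  by (simp add: tensor_of_def[abs_def])

abbreviation map_apply :: "('a \<Rightarrow> 'b) list \<Rightarrow> 'a list \<Rightarrow> 'b list" where
  "map_apply fs xs \<equiv> map2 (\<lambda>f x. f x) fs xs"

lemma multilinear_foldr_concat:
  assumes "\<forall>f\<in>set fs. linear f"
  shows "multilinear (\<lambda>xs. if length xs = length fs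
     then foldr tensor_concat (map_apply fs xs) (pure_tensor []) else 0)"
  using assms
proof (induction fs)
  case Nil
  show ?case by (rule multilinear_ConsI) (simp_all add: linear_zero multilinear_zero)
next
  case (Cons f fs)
  let ?M = "\<lambda>fs xs. if length xs = length fs
     then foldr tensor_concat (map_apply fs xs) (pure_tensor []) else 0"
  have Cons_eq: "?M (f # fs) (x # xs) = tensor_concat (f x) (?M fs xs)" for x xs
    by (simp add: bilinear_rzero[OF bilinear_tensor_concat])
  show ?case
  proof (rule multilinear_ConsI)
    show "linear (\<lambda>x. ?M (f # fs) (x # xs))" for xs
      unfolding Cons_eq using Cons.prems
      by (intro linear_compose[OF _ linear_tensor_concat_left, unfolded o_def]) simp
    show "multilinear (\<lambda>xs. ?M (f # fs) (x # xs))" for x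
      unfolding Cons_eq using Cons
      by (intro multilinear_compose[OF _ linear_tensor_concat_right]) simp
  qed
qed

lemma linear_tensor_maps: "\<forall>f\<in>set fs. linear f \<Longrightarrow> linear (tensor_maps fs)"
  unfolding tensor_maps_def by (intro linear_tensor_lift multilinear_foldr_concat)

lemma tensor_maps_pure:
  "\<forall>f\<in>set fs. linear f \<Longrightarrow> tensor_maps fs (pure_tensor xs) = (if length xs = length fs
     then foldr tensor_concat (map_apply fs xs) (pure_tensor []) else 0)"
  unfolding tensor_maps_def by (simp add: tensor_lift_pure multilinear_foldr_concat)

definition tensor_map ::
    "('a::real_vector \<Rightarrow> 'b::real_vector) list \<Rightarrow> 'a tensor \<Rightarrow> 'b tensor" where
  "tensor_map fs = tensor_maps (map ((\<circ>) tensor_of) fs)"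

lemma linear_comp_tensor_of: "\<forall>f\<in>set fs. linear f \<Longrightarrow> \<forall>f\<in>set (map ((\<circ>) tensor_of) fs). linear f"
  using linear_compose[OF _ linear_tensor_of] by auto

lemma linear_tensor_map: "\<forall>f\<in>set fs. linear f \<Longrightarrow> linear (tensor_map fs)"
  unfolding tensor_map_def by (intro linear_tensor_maps linear_comp_tensor_of)

lemma foldr_concat_tensor_of:
  "foldr tensor_concat (map_apply (map ((\<circ>) tensor_of) fs) xs) (pure_tensor [])
     = pure_tensor (map_apply fs xs)"
proof (induction fs arbitrary: xs)
  case (Cons f fs)
  then show ?case by (cases xs) (simp_all add: tensor_of_def tensor_concat_pure)
qed simp

lemma tensor_map_pure:
  "\<forall>f\<in>set fs. linear f \<Longrightarrow> tensor_map fs (pure_tensor xs) =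
    (if length xs = length fs then pure_tensor (map_apply fs xs) else 0)"
  unfolding tensor_map_def
  by (simp add: tensor_maps_pure linear_comp_tensor_of foldr_concat_tensor_of)

subsection \<open>Componentwise multiplication and reversal\<close>

lemma multilinear_pure_map_apply:
  assumes "\<forall>f\<in>set fs. linear f"
  shows "multilinear (\<lambda>xs. if length xs = length fs then pure_tensor (map_apply fs xs) else 0)"
  using multilinear_compose[OF multilinear_pure_tensor linear_tensor_map[OF assms]]
  by (simp only: tensor_map_pure[OF assms])

lemma multilinear_times_right:
  fixes xs :: "'a::real_algebra list"
  shows "multilinear (\<lambda>ys. if length xs = length ys then pure_tensor (map2 (*) xs ys) else 0)"
proof -
  have lin: "\<forall>f\<in>set (map (*) xs). linear f"
    by (auto intro!: linearI simp: algebra_simps)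
  have apply_eq: "map_apply (map (*) xs) ys = map2 (*) xs ys" for ys
    by (simp add: list_eq_iff_nth_eq)
  show ?thesis
    using multilinear_pure_map_apply[OF lin]
    unfolding apply_eq length_map eq_commute[of _ "length xs"] .
qed

lemma multilinear_times_left:
  fixes ys :: "'a::real_algebra list"
  shows "multilinear (\<lambda>xs. if length xs = length ys then pure_tensor (map2 (*) xs ys) else 0)"
proof -
  have lin: "\<forall>f\<in>set (map (\<lambda>y x. x * y) ys). linear f"
    by (auto intro!: linearI simp: algebra_simps)
  have apply_eq: "map_apply (map (\<lambda>y x. x * y) ys) xs = map2 (*) xs ys" for xs
    by (simp add: list_eq_iff_nth_eq)
  show ?thesis
    using multilinear_pure_map_apply[OF lin] unfolding apply_eq length_map .
qed

lemma tensor_times_pure: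
  "tensor_times (pure_tensor xs) (pure_tensor ys)
     = (if length xs = length ys then pure_tensor (map2 (*) xs ys) else 0)"
  unfolding tensor_times_def
  by (rule tensor_lift_lift_pure[OF multilinear_times_right multilinear_times_left])

lemma bilinear_tensor_times: "bilinear tensor_times"
  unfolding tensor_times_def[abs_def]
  by (rule bilinear_tensor_lift[OF multilinear_times_right multilinear_times_left])

lemma multilinear_rev: "multilinear (\<lambda>xs. pure_tensor (rev xs))"
  unfolding multilinear_def
proof (intro allI)
  fix us vs :: "'a list"
  show "linear (\<lambda>x. pure_tensor (rev (us @ x # vs)))"
    using multilinear_pure_tensor[unfolded multilinear_def, rule_format, of "rev vs" "rev us"]
    by simp
qed

lemma linear_tensor_rev: "linear tensor_rev"
  unfolding tensor_rev_def by (intro linear_tensor_lift multilinear_rev)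

lemma tensor_rev_pure: "tensor_rev (pure_tensor xs) = pure_tensor (rev xs)"
  unfolding tensor_rev_def by (simp add: tensor_lift_pure multilinear_rev)

lemma multilinear_prod_list: "multilinear (prod_list :: 'a::real_algebra_1 list \<Rightarrow> 'a)"
  unfolding multilinear_def by (intro allI linearI) (simp_all add: algebra_simps)

lemma linear_tensor_mult: "linear tensor_mult"
  unfolding tensor_mult_def by (intro linear_tensor_lift multilinear_prod_list)

lemma tensor_mult_pure: "tensor_mult (pure_tensor xs) = prod_list xs"
  unfolding tensor_mult_def by (simp add: tensor_lift_pure multilinear_prod_list)

section \<open>Evaluation of tensors\<close>

definition tensor_eval ::
    "('a::real_vector \<Rightarrow> 'b::real_algebra_1) list \<Rightarrow> 'a tensor \<Rightarrow> 'b" where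
  "tensor_eval fs t = tensor_mult (tensor_map fs t)"

lemma linear_tensor_eval: "\<forall>f\<in>set fs. linear f \<Longrightarrow> linear (tensor_eval fs)"
  unfolding tensor_eval_def[abs_def]
  by (rule linear_compose[OF linear_tensor_map linear_tensor_mult, unfolded o_def])

lemma tensor_eval_pure:
  "\<forall>f\<in>set fs. linear f \<Longrightarrow> tensor_eval fs (pure_tensor xs) =
     (if length xs = length fs then prod_list (map_apply fs xs) else 0)"
  by (simp add: tensor_eval_def tensor_map_pure tensor_mult_pure linear_0[OF linear_tensor_mult])

lemma tensor_eval_unique:
  assumes "linear F" "\<forall>f\<in>set fs. linear f"
    and "\<And>xs. F (pure_tensor xs) =
      (if length xs = length fs then prod_list (map_apply fs xs) else 0)"
  shows "F t = tensor_eval fs t"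
  by (rule linear_tensor_eqI[OF assms(1) linear_tensor_eval[OF assms(2)]])
    (simp add: assms(3) tensor_eval_pure[OF assms(2)])

lemma tensor_eval_tensor_of: "linear f \<Longrightarrow> tensor_eval [f] (tensor_of x) = f x"
  by (simp add: tensor_of_def tensor_eval_pure)

lemma tensor_eval_comp_tensor_of: "linear f \<Longrightarrow> tensor_eval [f] \<circ> tensor_of = f"
  by (simp add: fun_eq_iff tensor_eval_tensor_of)

lemma tensor_eval_map:
  assumes fs: "\<forall>f\<in>set fs. linear f" and gs: "\<forall>g\<in>set gs. linear g" and "length gs = length fs"
  shows "tensor_eval gs (tensor_map fs t) = tensor_eval (map2 (\<circ>) gs fs) t"
proof (rule tensor_eval_unique)
  show "linear (\<lambda>t. tensor_eval gs (tensor_map fs t))"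
    by (rule linear_compose[OF linear_tensor_map[OF fs] linear_tensor_eval[OF gs], unfolded o_def])
  show "\<forall>h\<in>set (map2 (\<circ>) gs fs). linear h"
    using fs gs by (auto elim!: in_set_zipE intro: linear_compose)
  fix xs
  have "map_apply gs (map_apply fs xs) = map_apply (map2 (\<circ>) gs fs) xs"
    by (simp add: list_eq_iff_nth_eq)
  then show "tensor_eval gs (tensor_map fs (pure_tensor xs))
      = (if length xs = length (map2 (\<circ>) gs fs)
         then prod_list (map_apply (map2 (\<circ>) gs fs) xs) else 0)"
    using assms
    by (simp add: tensor_map_pure tensor_eval_pure linear_0[OF linear_tensor_eval[OF gs]])
qed

lemma tensor_eval_rev:
  fixes fs :: "('a::real_vector \<Rightarrow> 'b::{real_algebra_1, comm_ring_1}) list"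
  assumes fs: "\<forall>f\<in>set fs. linear f"
  shows "tensor_eval fs (tensor_rev t) = tensor_eval (rev fs) t"
proof (rule tensor_eval_unique)
  show "linear (\<lambda>t. tensor_eval fs (tensor_rev t))"
    by (rule linear_compose[OF linear_tensor_rev linear_tensor_eval[OF fs], unfolded o_def])
  fix xs :: "'a list"
  have "prod_list (map_apply fs (rev xs)) = prod_list (map_apply (rev fs) xs)"
    if "length xs = length fs"
    using prod_list.rev[of "map_apply fs (rev xs)"] zip_rev[of fs "rev xs"] that
    by (simp add: rev_map)
  then show "tensor_eval fs (tensor_rev (pure_tensor xs))
      = (if length xs = length (rev fs) then prod_list (map_apply (rev fs) xs) else 0)"
    by (simp add: tensor_rev_pure tensor_eval_pure[OF fs])
qed (use fs in simp)

definition tensor_power :: "nat \<Rightarrow> 'a::real_vector tensor set" where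
  "tensor_power k = span {pure_tensor xs |xs. length xs = k}"

lemma pure_tensor_in_tensor_power: "length xs = k \<Longrightarrow> pure_tensor xs \<in> tensor_power k"
  unfolding tensor_power_def by (rule span_base) auto

lemma tensor_of_in_tensor_power: "tensor_of x \<in> tensor_power (Suc 0)"
  by (simp add: tensor_of_def pure_tensor_in_tensor_power)

lemma scalar_tensor_in_tensor_power: "scalar_tensor \<epsilon> x \<in> tensor_power 0"
  by (simp add: scalar_tensor_def tensor_power_def span_scale span_base)

lemma tensor_eval_concat:
  assumes fs: "\<forall>f\<in>set fs. linear f" and gs: "\<forall>g\<in>set gs. linear g"
    and s: "s \<in> tensor_power (length fs)"
  shows "tensor_eval (fs @ gs) (tensor_concat s t) = tensor_eval fs s * tensor_eval gs t"
proof -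
  have fgs: "\<forall>f\<in>set (fs @ gs). linear f" using fs gs by auto
  have "bilinear (\<lambda>s t. tensor_eval (fs @ gs) (tensor_concat s t))"
    by (rule bilinear_compose_linear[OF bilinear_tensor_concat linear_tensor_eval[OF fgs]])
  moreover have "bilinear (\<lambda>s t. tensor_eval fs s * tensor_eval gs t)"
    using fs gs by (intro bilinear_linear_arguments[OF bilinear_times] linear_tensor_eval)
  moreover have "tensor_eval (fs @ gs) (tensor_concat x y) = tensor_eval fs x * tensor_eval gs y"
    if "x \<in> {pure_tensor xs |xs. length xs = length fs}" "y \<in> range pure_tensor" for x y
    using that fs gs fgs by (auto simp: tensor_concat_pure tensor_eval_pure)
  ultimately show ?thesis
    by (rule bilinear_eq[OF _ _ order_refl order_refl s[unfolded tensor_power_def]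
          tensor_in_span_pure])
qed

lemma tensor_eval_maps_pair:
  assumes f: "linear f" "range f \<subseteq> tensor_power (length \<phi>s)" and g: "linear g"
    and \<phi>s: "\<forall>\<phi>\<in>set \<phi>s. linear \<phi>" and \<psi>s: "\<forall>\<psi>\<in>set \<psi>s. linear \<psi>"
  shows "tensor_eval (\<phi>s @ \<psi>s) (tensor_maps [f, g] t)
    = tensor_eval [tensor_eval \<phi>s \<circ> f, tensor_eval \<psi>s \<circ> g] t"
proof (rule tensor_eval_unique)
  have fg: "\<forall>h\<in>set [f, g]. linear h" using f g by simp
  have lin: "linear (tensor_eval (\<phi>s @ \<psi>s))"
    using \<phi>s \<psi>s by (auto intro!: linear_tensor_eval)
  show "linear (\<lambda>t. tensor_eval (\<phi>s @ \<psi>s) (tensor_maps [f, g] t))"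
    by (rule linear_compose[OF linear_tensor_maps[OF fg] lin, unfolded o_def])
  show "\<forall>h\<in>set [tensor_eval \<phi>s \<circ> f, tensor_eval \<psi>s \<circ> g]. linear h"
    using f g \<phi>s \<psi>s by (auto intro!: linear_compose linear_tensor_eval)
  show "tensor_eval (\<phi>s @ \<psi>s) (tensor_maps [f, g] (pure_tensor xs))
      = (if length xs = length [tensor_eval \<phi>s \<circ> f, tensor_eval \<psi>s \<circ> g]
         then prod_list (map_apply [tensor_eval \<phi>s \<circ> f, tensor_eval \<psi>s \<circ> g] xs) else 0)" for xs
    using f(2) \<phi>s \<psi>s
    by (auto simp: tensor_maps_pure[OF fg] linear_0[OF lin] length_Suc_conv
        tensor_concat_Nil_right tensor_eval_concat image_subset_iff)
qed

lemma linear_scalar_tensor: "linear \<epsilon> \<Longrightarrow> linear (scalar_tensor \<epsilon>)"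
  unfolding scalar_tensor_def[abs_def]
  by (rule linearI) (simp_all add: linear_add linear_scale scaleR_add_left)

lemma tensor_eval_comp_scalar_tensor: "tensor_eval [] \<circ> scalar_tensor \<epsilon> = (of_real \<circ> \<epsilon>)"
  by (simp add: fun_eq_iff scalar_tensor_def linear_scale[OF linear_tensor_eval] tensor_eval_pure
      of_real_def)

section \<open>Binomial and multinomial coefficients\<close>

lemma sum_binomial_Suc:
  fixes a :: "nat \<Rightarrow> nat \<Rightarrow> 'a::comm_semiring_1"
  shows "(\<Sum>k\<le>n. of_nat (n choose k) * (a k (Suc (n - k)) + a (Suc k) (n - k)))
    = (\<Sum>k\<le>Suc n. of_nat (Suc n choose k) * a k (Suc n - k))"
proof -
  have "(\<Sum>k\<le>n. of_nat (n choose k) * a k (Suc (n - k)))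
      = (\<Sum>k\<le>Suc n. of_nat (n choose k) * a k (Suc n - k))"
    by (simp add: Suc_diff_le binomial_eq_0)
  also have "\<dots> = a 0 (Suc n) + (\<Sum>k\<le>n. of_nat (n choose Suc k) * a (Suc k) (n - k))"
    by (subst sum.atMost_Suc_shift) simp
  finally show ?thesis
    by (subst sum.atMost_Suc_shift) (simp add: sum.distrib algebra_simps)
qed

lemma multinomial_Cons: "multinomial (e # E) = real (e + sum_list E choose e) * multinomial E"
  by (simp add: multinomial_def binomial_fact)

lemma multinomial_pos: "multinomial E > 0"
proof -
  have "prod_list (map fact E) > (0::real)" by (induction E) auto
  then show ?thesis by (simp add: multinomial_def)
qed

section \<open>Convolution of linear functionals\<close>

locale coalgebra =
  fixes \<Delta> :: "'h::real_vector \<Rightarrow> 'h tensor" and \<epsilon> :: "'h \<Rightarrow> real"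
  assumes linear_coprod: "linear \<Delta>"
    and coprod_in_tensor_power: "\<Delta> x \<in> tensor_power 2"
    and linear_counit: "linear \<epsilon>"
    and coprod_assoc: "tensor_maps [\<Delta>, tensor_of] (\<Delta> x) = tensor_maps [tensor_of, \<Delta>] (\<Delta> x)"
    and coprod_counit_left: "tensor_maps [scalar_tensor \<epsilon>, tensor_of] (\<Delta> x) = tensor_of x"
    and coprod_counit_right: "tensor_maps [tensor_of, scalar_tensor \<epsilon>] (\<Delta> x) = tensor_of x"
begin

definition conv :: "('h \<Rightarrow> real) \<Rightarrow> ('h \<Rightarrow> real) \<Rightarrow> 'h \<Rightarrow> real" where
  "conv \<phi> \<psi> = tensor_eval [\<phi>, \<psi>] \<circ> \<Delta>"

lemma linear_conv: "linear \<phi> \<Longrightarrow> linear \<psi> \<Longrightarrow> linear (conv \<phi> \<psi>)"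
  unfolding conv_def by (intro linear_compose[OF linear_coprod] linear_tensor_eval) simp

lemma conv_assoc:
  assumes "linear \<phi>" "linear \<psi>" "linear \<theta>"
  shows "conv (conv \<phi> \<psi>) \<theta> = conv \<phi> (conv \<psi> \<theta>)"
proof
  fix x
  have "conv (conv \<phi> \<psi>) \<theta> x = tensor_eval ([\<phi>, \<psi>] @ [\<theta>]) (tensor_maps [\<Delta>, tensor_of] (\<Delta> x))"
    using assms coprod_in_tensor_power
    by (subst tensor_eval_maps_pair)
      (auto simp: linear_coprod linear_tensor_of tensor_eval_comp_tensor_of conv_def numeral_2_eq_2)
  also have "\<dots> = tensor_eval ([\<phi>] @ [\<psi>, \<theta>]) (tensor_maps [tensor_of, \<Delta>] (\<Delta> x))"
    by (simp add: coprod_assoc)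
  also have "\<dots> = conv \<phi> (conv \<psi> \<theta>) x"
    using assms tensor_of_in_tensor_power
    by (subst tensor_eval_maps_pair)
      (auto simp: linear_coprod linear_tensor_of tensor_eval_comp_tensor_of conv_def)
  finally show "conv (conv \<phi> \<psi>) \<theta> x = conv \<phi> (conv \<psi> \<theta>) x" .
qed

lemma conv_counit_left:
  assumes "linear \<phi>"
  shows "conv \<epsilon> \<phi> = \<phi>"
proof
  fix x
  have "conv \<epsilon> \<phi> x = tensor_eval ([] @ [\<phi>]) (tensor_maps [scalar_tensor \<epsilon>, tensor_of] (\<Delta> x))"
    using assms scalar_tensor_in_tensor_power
    by (subst tensor_eval_maps_pair)
      (auto simp: linear_scalar_tensor linear_counit linear_tensor_of tensor_eval_comp_tensor_of
        tensor_eval_comp_scalar_tensor conv_def)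
  then show "conv \<epsilon> \<phi> x = \<phi> x"
    by (simp add: coprod_counit_left assms tensor_eval_tensor_of)
qed

lemma conv_counit_right:
  assumes "linear \<phi>"
  shows "conv \<phi> \<epsilon> = \<phi>"
proof
  fix x
  have "conv \<phi> \<epsilon> x = tensor_eval ([\<phi>] @ []) (tensor_maps [tensor_of, scalar_tensor \<epsilon>] (\<Delta> x))"
    using assms tensor_of_in_tensor_power
    by (subst tensor_eval_maps_pair)
      (auto simp: linear_scalar_tensor linear_counit linear_tensor_of tensor_eval_comp_tensor_of
        tensor_eval_comp_scalar_tensor conv_def)
  then show "conv \<phi> \<epsilon> x = \<phi> x"
    by (simp add: coprod_counit_right assms tensor_eval_tensor_of)
qed

lemma linear_iterated_coprod: "linear (iterated_coprod \<Delta> \<epsilon> l)"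
proof (induction l rule: induct_nat_012)
  case 0
  show ?case by (simp add: linear_scalar_tensor linear_counit)
next
  case 1
  show ?case by (simp add: linear_tensor_of)
next
  case (ge2 l)
  then show ?case
    using linear_compose[OF linear_coprod linear_tensor_maps,
        of "[tensor_of, iterated_coprod \<Delta> \<epsilon> (Suc l)]"]
    by (simp add: o_def linear_tensor_of)
qed

lemma tensor_eval_iterated_coprod:
  assumes "\<forall>\<phi>\<in>set \<phi>s. linear \<phi>"
  shows "tensor_eval \<phi>s \<circ> iterated_coprod \<Delta> \<epsilon> (length \<phi>s) = foldr conv \<phi>s \<epsilon>"
  using assms
proof (induction \<phi>s)
  case Nil
  show ?case by (simp add: tensor_eval_comp_scalar_tensor)
next
  case (Cons \<phi> \<phi>s)
  show ?case
  proof (cases \<phi>s)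
    case Nil
    with Cons.prems show ?thesis by (simp add: tensor_eval_comp_tensor_of conv_counit_right)
  next
    case (Cons \<psi> \<psi>s)
    let ?\<Delta>\<^sub>l = "iterated_coprod \<Delta> \<epsilon> (length \<phi>s)"
    have "tensor_eval (\<phi> # \<phi>s) \<circ> iterated_coprod \<Delta> \<epsilon> (length (\<phi> # \<phi>s))
      = (\<lambda>x. tensor_eval ([\<phi>] @ \<phi>s) (tensor_maps [tensor_of, ?\<Delta>\<^sub>l] (\<Delta> x)))"
      using Cons by (simp add: o_def)
    also have "\<dots> = conv \<phi> (tensor_eval \<phi>s \<circ> ?\<Delta>\<^sub>l)"
      using Cons.prems tensor_of_in_tensor_power
      by (subst tensor_eval_maps_pair)
        (auto simp: linear_tensor_of linear_iterated_coprod tensor_eval_comp_tensor_of conv_def)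
    finally show ?thesis
      using Cons.IH Cons.prems by simp
  qed
qed

definition conv_power :: "('h \<Rightarrow> real) \<Rightarrow> nat \<Rightarrow> 'h \<Rightarrow> real" where
  "conv_power \<phi> k = (conv \<phi> ^^ k) \<epsilon>"

lemma conv_power_0 [simp]: "conv_power \<phi> 0 = \<epsilon>"
  and conv_power_Suc: "conv_power \<phi> (Suc k) = conv \<phi> (conv_power \<phi> k)"
  by (simp_all add: conv_power_def)

lemma conv_power_1: "linear \<phi> \<Longrightarrow> conv_power \<phi> (Suc 0) = \<phi>"
  by (simp add: conv_power_Suc conv_counit_right)

lemma linear_conv_power: "linear \<phi> \<Longrightarrow> linear (conv_power \<phi> k)"
  by (induction k) (simp_all add: conv_power_Suc linear_counit linear_conv)

lemma conv_power_add:
  "linear \<phi> \<Longrightarrow> conv_power \<phi> (i + j) = conv (conv_power \<phi> i) (conv_power \<phi> j)"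
  by (induction i) (simp_all add: conv_power_Suc conv_counit_left conv_assoc linear_conv_power)

lemma conv_power_Suc_right: "linear \<phi> \<Longrightarrow> conv_power \<phi> (Suc k) = conv (conv_power \<phi> k) \<phi>"
  using conv_power_add[of \<phi> k "Suc 0"] by (simp add: conv_power_1)

lemma foldr_conv_power: "linear \<phi> \<Longrightarrow> foldr conv (map (conv_power \<phi>) E) \<epsilon> = conv_power \<phi> (sum_list E)"
  by (induction E) (simp_all add: conv_power_add)

lemma conv_comp_coalgebra_morphism:
  assumes "coalgebra_morphism \<Delta> \<epsilon> f" "linear \<phi>" "linear \<psi>"
  shows "conv \<phi> \<psi> \<circ> f = conv (\<phi> \<circ> f) (\<psi> \<circ> f)"
  using assms tensor_eval_map[of "[f, f]" "[\<phi>, \<psi>]"]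
  by (auto simp: coalgebra_morphism_def conv_def tensor_map_def)

lemma conv_comp_coalgebra_antimorphism:
  assumes "coalgebra_antimorphism \<Delta> \<epsilon> f" "linear \<phi>" "linear \<psi>"
  shows "conv \<phi> \<psi> \<circ> f = conv (\<psi> \<circ> f) (\<phi> \<circ> f)"
  using assms tensor_eval_map[of "[f, f]" "[\<psi>, \<phi>]"]
  by (auto simp: coalgebra_antimorphism_def conv_def tensor_map_def tensor_eval_rev)

lemma conv_power_comp_ambimorphism:
  assumes f: "coalgebra_morphism \<Delta> \<epsilon> f \<or> coalgebra_antimorphism \<Delta> \<epsilon> f" and \<phi>: "linear \<phi>"
  shows "conv_power \<phi> k \<circ> f = conv_power (\<phi> \<circ> f) k"
proof (induction k)
  case 0
  show ?case using f by (auto simp: coalgebra_morphism_def coalgebra_antimorphism_def)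
next
  case (Suc k)
  have \<phi>f: "linear (\<phi> \<circ> f)"
    using f \<phi>
    by (auto simp: coalgebra_morphism_def coalgebra_antimorphism_def intro: linear_compose)
  from f show ?case
  proof
    assume "coalgebra_morphism \<Delta> \<epsilon> f"
    then have "conv_power \<phi> (Suc k) \<circ> f = conv (\<phi> \<circ> f) (conv_power \<phi> k \<circ> f)"
      unfolding conv_power_Suc
      by (rule conv_comp_coalgebra_morphism[OF _ \<phi> linear_conv_power[OF \<phi>]])
    then show ?thesis by (simp only: Suc.IH conv_power_Suc)
  next
    assume "coalgebra_antimorphism \<Delta> \<epsilon> f"
    then have "conv_power \<phi> (Suc k) \<circ> f = conv (conv_power \<phi> k \<circ> f) (\<phi> \<circ> f)"
      unfolding conv_power_Suc
      by (rule conv_comp_coalgebra_antimorphism[OF _ \<phi> linear_conv_power[OF \<phi>]])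
    then show ?thesis by (simp only: Suc.IH conv_power_Suc_right[OF \<phi>f])
  qed
qed

end

section \<open>The binomial theorem for infinitesimal characters\<close>

locale bialgebra = coalgebra \<Delta> \<epsilon>
  for \<Delta> :: "'h::real_algebra_1 \<Rightarrow> 'h tensor" and \<epsilon> +
  assumes coprod_times: "\<Delta> (x * y) = tensor_times (\<Delta> x) (\<Delta> y)"
    and counit_times: "\<epsilon> (x * y) = \<epsilon> x * \<epsilon> y"
begin

definition infinitesimal_character :: "('h \<Rightarrow> real) \<Rightarrow> bool" where
  "infinitesimal_character \<delta> \<longleftrightarrow> linear \<delta> \<and> (\<forall>x y. \<delta> (x * y) = \<epsilon> x * \<delta> y + \<delta> x * \<epsilon> y)"

lemma tensor_eval_times_infinitesimal_character:
  fixes c :: "'k \<Rightarrow> real"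
  assumes \<delta>: "infinitesimal_character \<delta>"
    and lin: "linear \<psi>" "\<And>k. linear (\<psi>\<^sub>1 k)" "\<And>k. linear (\<psi>\<^sub>2 k)"
    and \<psi>: "\<And>x y. \<psi> (x * y) = (\<Sum>k\<in>K. c k * (\<psi>\<^sub>1 k x * \<psi>\<^sub>2 k y))"
  shows "tensor_eval [\<delta>, \<psi>] (tensor_times s t) = (\<Sum>k\<in>K. c k *
    (tensor_eval [\<epsilon>, \<psi>\<^sub>1 k] s * tensor_eval [\<delta>, \<psi>\<^sub>2 k] t
      + tensor_eval [\<delta>, \<psi>\<^sub>1 k] s * tensor_eval [\<epsilon>, \<psi>\<^sub>2 k] t))"
proof (rule bilinear_tensor_eqI)
  have lin_\<delta>: "linear \<delta>" and \<delta>_times: "\<delta> (x * y) = \<epsilon> x * \<delta> y + \<delta> x * \<epsilon> y" for x y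
    using \<delta> by (simp_all add: infinitesimal_character_def)
  note linear_pair = linear_tensor_eval[of "[_, _]", simplified]
  show "bilinear (\<lambda>s t. tensor_eval [\<delta>, \<psi>] (tensor_times s t))"
    by (rule bilinear_compose_linear[OF bilinear_tensor_times linear_pair])
      (simp add: lin lin_\<delta>)
  show "bilinear (\<lambda>s t. \<Sum>k\<in>K. c k *
    (tensor_eval [\<epsilon>, \<psi>\<^sub>1 k] s * tensor_eval [\<delta>, \<psi>\<^sub>2 k] t
      + tensor_eval [\<delta>, \<psi>\<^sub>1 k] s * tensor_eval [\<epsilon>, \<psi>\<^sub>2 k] t))"
    unfolding bilinear_def
    by (intro conjI allI linearI)
      (simp_all add: linear_add[OF linear_pair] linear_scale[OF linear_pair] lin lin_\<delta> linear_counit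
        sum.distrib sum_distrib_left algebra_simps)
  fix xs ys :: "'h list"
  show "tensor_eval [\<delta>, \<psi>] (tensor_times (pure_tensor xs) (pure_tensor ys)) = (\<Sum>k\<in>K. c k *
    (tensor_eval [\<epsilon>, \<psi>\<^sub>1 k] (pure_tensor xs) * tensor_eval [\<delta>, \<psi>\<^sub>2 k] (pure_tensor ys)
      + tensor_eval [\<delta>, \<psi>\<^sub>1 k] (pure_tensor xs) * tensor_eval [\<epsilon>, \<psi>\<^sub>2 k] (pure_tensor ys)))"
  proof (cases "length xs = 2 \<and> length ys = 2")
    case True
    then show ?thesis
      by (auto simp: tensor_times_pure tensor_eval_pure lin lin_\<delta> linear_counit \<delta>_times \<psi>
          length_Suc_conv numeral_2_eq_2 sum_distrib_left algebra_simps)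
  next
    case False
    then show ?thesis
      by (auto simp: tensor_times_pure tensor_eval_pure lin lin_\<delta> linear_counit
          linear_0[OF linear_pair])
  qed
qed

lemma conv_infinitesimal_character_times:
  fixes c :: "'k \<Rightarrow> real"
  assumes "infinitesimal_character \<delta>"
    and lin: "linear \<psi>" "\<And>k. linear (\<psi>\<^sub>1 k)" "\<And>k. linear (\<psi>\<^sub>2 k)"
    and "\<And>x y. \<psi> (x * y) = (\<Sum>k\<in>K. c k * (\<psi>\<^sub>1 k x * \<psi>\<^sub>2 k y))"
  shows "conv \<delta> \<psi> (x * y)
    = (\<Sum>k\<in>K. c k * (\<psi>\<^sub>1 k x * conv \<delta> (\<psi>\<^sub>2 k) y + conv \<delta> (\<psi>\<^sub>1 k) x * \<psi>\<^sub>2 k y))"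
proof -
  have "tensor_eval [\<epsilon>, \<phi>] (\<Delta> z) = \<phi> z" if "linear \<phi>" for \<phi> z
    using conv_counit_left[OF that] by (metis comp_apply conv_def)
  then show ?thesis
    by (simp add: conv_def coprod_times tensor_eval_times_infinitesimal_character[OF assms] lin)
qed

lemma conv_power_times_binomial:
  assumes \<delta>: "infinitesimal_character \<delta>"
  shows "conv_power \<delta> n (x * y) =
    (\<Sum>k\<le>n. real (n choose k) * (conv_power \<delta> k x * conv_power \<delta> (n - k) y))"
proof (induction n arbitrary: x y)
  case 0
  show ?case by (simp add: counit_times)
next
  case (Suc n)
  have "linear (conv_power \<delta> k)" for k
    using \<delta> by (simp add: infinitesimal_character_def linear_conv_power)
  then have "conv_power \<delta> (Suc n) (x * y) = (\<Sum>k\<le>n. real (n choose k) *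
      (conv_power \<delta> k x * conv_power \<delta> (Suc (n - k)) y
        + conv_power \<delta> (Suc k) x * conv_power \<delta> (n - k) y))"
    unfolding conv_power_Suc by (intro conv_infinitesimal_character_times \<delta> Suc.IH)
  also have "\<dots> = (\<Sum>k\<le>Suc n. real (Suc n choose k) *
      (conv_power \<delta> k x * conv_power \<delta> (Suc n - k) y))"
    by (rule sum_binomial_Suc)
  finally show ?case .
qed

end

section \<open>Graded vector spaces\<close>

context
  fixes H :: "nat \<Rightarrow> 'h::real_vector set"
  assumes graded: "graded_vector_space H"
begin

lemma subspace_graded: "subspace (H n)"
  using graded by (simp add: graded_vector_space_def)

lemma in_span_graded: "x \<in> span (\<Union>n. H n)"
  using graded by (simp add: graded_vector_space_def)

lemma graded_disjoint: "x \<in> H n \<Longrightarrow> x \<in> span (\<Union>k\<in>- {n}. H k) \<Longrightarrow> x = 0"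
  using graded by (auto simp: graded_vector_space_def)

lemma graded_decomposition: "\<exists>!u. u \<in> H n \<and> v - u \<in> span (\<Union>k\<in>- {n}. H k)"
proof -
  have "v \<in> span (H n \<union> (\<Union>k\<in>- {n}. H k))"
    by (rule subsetD[OF span_mono in_span_graded]) auto
  then obtain u where u: "u \<in> H n" "v - u \<in> span (\<Union>k\<in>- {n}. H k)"
    unfolding span_Un span_eq_iff[THEN iffD2, OF subspace_graded] by auto
  moreover have "u' = u" if u': "u' \<in> H n" "v - u' \<in> span (\<Union>k\<in>- {n}. H k)" for u'
  proof -
    have "u' - u \<in> H n"
      using u' u by (intro subspace_diff subspace_graded)
    moreover have "u' - u \<in> span (\<Union>k\<in>- {n}. H k)"
      using span_diff[OF u(2) u'(2)] by simp
    ultimately have "u' - u = 0" by (rule graded_disjoint)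
    then show ?thesis by simp
  qed
  ultimately show ?thesis by blast
qed

lemma graded_proj_in: "graded_proj H n v \<in> H n"
  and diff_graded_proj_in: "v - graded_proj H n v \<in> span (\<Union>k\<in>- {n}. H k)"
  using theI'[OF graded_decomposition, of n v] by (simp_all add: graded_proj_def)

lemma graded_proj_eqI:
  "u \<in> H n \<Longrightarrow> v - u \<in> span (\<Union>k\<in>- {n}. H k) \<Longrightarrow> graded_proj H n v = u"
  using graded_decomposition graded_proj_in diff_graded_proj_in by blast

lemma graded_proj_same: "v \<in> H n \<Longrightarrow> graded_proj H n v = v"
  by (rule graded_proj_eqI) (simp_all add: span_zero)

lemma graded_proj_other: "v \<in> H k \<Longrightarrow> k \<noteq> n \<Longrightarrow> graded_proj H n v = 0"
  by (rule graded_proj_eqI) (auto simp: subspace_0 subspace_graded intro!: span_base)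

lemma linear_graded_proj: "linear (graded_proj H n)"
proof (rule linearI)
  fix v w :: 'h and c :: real
  have "(v - graded_proj H n v) + (w - graded_proj H n w) \<in> span (\<Union>k\<in>- {n}. H k)"
    by (intro span_add diff_graded_proj_in)
  then show "graded_proj H n (v + w) = graded_proj H n v + graded_proj H n w"
    by (intro graded_proj_eqI)
      (simp_all add: subspace_add subspace_graded graded_proj_in algebra_simps)
  have "c *\<^sub>R (v - graded_proj H n v) \<in> span (\<Union>k\<in>- {n}. H k)"
    by (intro span_scale diff_graded_proj_in)
  then show "graded_proj H n (c *\<^sub>R v) = c *\<^sub>R graded_proj H n v"
    by (intro graded_proj_eqI)
      (simp_all add: subspace_scale subspace_graded graded_proj_in algebra_simps)
qed

end

definition homogeneous ::
    "(nat \<Rightarrow> 'h::real_vector set) \<Rightarrow> nat \<Rightarrow> ('h \<Rightarrow> 'b::real_vector) \<Rightarrow> bool" where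
  "homogeneous H n \<phi> \<longleftrightarrow> linear \<phi> \<and> (\<forall>k x. k \<noteq> n \<longrightarrow> x \<in> H k \<longrightarrow> \<phi> x = 0)"

lemma homogeneous_imp_linear: "homogeneous H n \<phi> \<Longrightarrow> linear \<phi>"
  by (simp add: homogeneous_def)

lemma homogeneous_eq_0: "homogeneous H n \<phi> \<Longrightarrow> x \<in> H k \<Longrightarrow> k \<noteq> n \<Longrightarrow> \<phi> x = 0"
  by (simp add: homogeneous_def)

lemma homogeneous_comp_graded_proj:
  assumes "graded_vector_space H" and \<phi>: "homogeneous H n \<phi>"
  shows "\<phi> \<circ> graded_proj H n = \<phi>"
proof
  fix v
  have "\<phi> (v - graded_proj H n v) = 0"
    by (rule linear_eq_0_on_span[OF homogeneous_imp_linear[OF \<phi>] _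
          diff_graded_proj_in[OF assms(1)]]) (auto intro: homogeneous_eq_0[OF \<phi>])
  then show "(\<phi> \<circ> graded_proj H n) v = \<phi> v"
    by (simp add: linear_diff[OF homogeneous_imp_linear[OF \<phi>]])
qed

locale graded_basis =
  fixes H B :: "nat \<Rightarrow> 'h::real_vector set"
  assumes graded_H: "graded_vector_space H"
    and independent_basis: "independent (B k)"
    and span_basis: "span (B k) = H k"
begin

lemma basis_in_graded: "b \<in> B k \<Longrightarrow> b \<in> H k"
  using span_basis span_base by blast

lemma span_Union_basis: "span (\<Union>n. B n) = UNIV"
proof -
  have "(\<Union>n. H n) \<subseteq> span (\<Union>n. B n)"
    using span_basis span_mono[of "B _" "\<Union>n. B n"] by auto
  then have "span (\<Union>n. H n) \<subseteq> span (\<Union>n. B n)"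
    by (rule span_minimal) (rule subspace_span)
  then show ?thesis using in_span_graded[OF graded_H] by auto
qed

lemma graded_proj_basis: "b \<in> B k \<Longrightarrow> graded_proj H n b = (if k = n then b else 0)"
  using graded_proj_same[OF graded_H basis_in_graded]
    graded_proj_other[OF graded_H basis_in_graded] by auto

lemma basis_nonzero: "0 \<notin> B k"
  using independent_basis dependent_zero by blast

lemma basis_degree_unique: "b \<in> B j \<Longrightarrow> b \<in> B k \<Longrightarrow> j = k"
  using graded_proj_basis[of b j j] graded_proj_basis[of b k j] basis_nonzero[of j] by metis

lemma independent_Union_basis: "independent (\<Union>n. B n)"
  unfolding independent_explicit_finite_subsets
proof (intro allI impI ballI)
  fix A u b
  assume A: "A \<subseteq> (\<Union>n. B n)" "finite A" and sum0: "(\<Sum>v\<in>A. u v *\<^sub>R v) = 0" and b: "b \<in> A"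
  from A b obtain n where n: "b \<in> B n" by auto
  have proj: "graded_proj H n v = (if v \<in> B n then v else 0)" if "v \<in> A" for v
    using A that graded_proj_basis by fastforce
  have "0 = graded_proj H n (\<Sum>v\<in>A. u v *\<^sub>R v)"
    by (simp add: sum0 linear_0[OF linear_graded_proj[OF graded_H]])
  also have "\<dots> = (\<Sum>v\<in>A. if v \<in> B n then u v *\<^sub>R v else 0)"
    unfolding linear_sum[OF linear_graded_proj[OF graded_H]]
    by (intro sum.cong) (simp_all add: linear_scale[OF linear_graded_proj[OF graded_H]] proj)
  also have "\<dots> = (\<Sum>v\<in>A \<inter> B n. u v *\<^sub>R v)"
    using A(2) by (rule sum.inter_restrict[symmetric])
  finally show "u b = 0"
    using independentD[OF independent_basis[of n], of "A \<inter> B n" u b] A(2) b n by simp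
qed

lemma linear_eq_on_basis:
  assumes "linear f" "linear g" "\<And>k b. b \<in> B k \<Longrightarrow> f b = g b"
  shows "f = g"
proof
  show "f x = g x" for x
    by (rule linear_eq_on_span[OF assms(1,2), of "\<Union>n. B n"])
      (use assms(3) span_Union_basis in auto)
qed

lemma linear_linear_ext: "linear (linear_ext B \<tau>)"
  unfolding linear_ext_def by (rule linear_construct[OF independent_Union_basis])

lemma linear_ext_basis: "b \<in> B k \<Longrightarrow> linear_ext B \<tau> b = \<tau> b"
  unfolding linear_ext_def by (rule construct_basis[OF independent_Union_basis]) auto

end

section \<open>Homogeneous functionals on a graded connected Hopf algebra\<close>

sublocale graded_connected_hopf_algebra \<subseteq> bialgebra \<Delta> \<epsilon>
proof (intro bialgebra.intro coalgebra.intro bialgebra_axioms.intro)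
  fix x
  show "\<Delta> x \<in> tensor_power 2"
    unfolding tensor_power_def
  proof (rule linear_image_in_span[OF coprod_linear in_span_graded[OF graded]])
    fix s assume "s \<in> (\<Union>n. H n)"
    then obtain n where "s \<in> H n" by auto
    then show "\<Delta> s \<in> span {pure_tensor xs |xs. length xs = 2}"
      by (rule subsetD[OF span_mono coprod_graded, rotated]) auto
  qed
qed (fact coprod_linear counit_linear coassoc counit_left counit_right coprod_mult counit_mult)+

context graded_connected_hopf_algebra
begin

lemma one_in_graded: "1 \<in> H 0"
  by (simp add: connected span_base)

lemma homogeneous_counit: "homogeneous H 0 \<epsilon>"
  by (simp add: homogeneous_def counit_linear counit_graded)

lemma homogeneous_conv:
  assumes \<phi>: "homogeneous H i \<phi>" and \<psi>: "homogeneous H j \<psi>"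
  shows "homogeneous H (i + j) (conv \<phi> \<psi>)"
proof -
  have lin: "linear \<phi>" "linear \<psi>"
    using \<phi> \<psi> by (simp_all add: homogeneous_imp_linear)
  have "tensor_eval [\<phi>, \<psi>] (\<Delta> x) = 0" if x: "x \<in> H m" and m: "m \<noteq> i + j" for x m
  proof (rule linear_eq_0_on_span[OF _ _ coprod_graded[OF x]])
    show "linear (tensor_eval [\<phi>, \<psi>])" by (simp add: linear_tensor_eval lin)
    fix t assume "t \<in> (\<Union>k\<le>m. {pure_tensor [u, v] |u v. u \<in> H k \<and> v \<in> H (m - k)})"
    then obtain k u v where t: "t = pure_tensor [u, v]" and "k \<le> m" "u \<in> H k" "v \<in> H (m - k)"
      by auto
    then have "\<phi> u * \<psi> v = 0"
      using m homogeneous_eq_0[OF \<phi>, of u k] homogeneous_eq_0[OF \<psi>, of v "m - k"] by fastforce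
    then show "tensor_eval [\<phi>, \<psi>] t = 0"
      by (simp add: t tensor_eval_pure lin)
  qed
  then show ?thesis
    by (simp add: homogeneous_def linear_conv lin) (simp add: conv_def)
qed

lemma homogeneous_conv_power: "homogeneous H m \<phi> \<Longrightarrow> homogeneous H (k * m) (conv_power \<phi> k)"
  by (induction k) (simp_all add: conv_power_Suc homogeneous_counit homogeneous_conv)

lemma homogeneous_1_times:
  assumes \<delta>: "homogeneous H 1 \<delta>" and x: "x \<in> H i" and y: "y \<in> H j"
  shows "\<delta> (x * y) = \<epsilon> x * \<delta> y + \<delta> x * \<epsilon> y"
proof -
  note lin = homogeneous_imp_linear[OF \<delta>]
  have \<delta>_1: "\<delta> 1 = 0"
    using homogeneous_eq_0[OF \<delta> one_in_graded] by simp
  have scalar: "\<exists>c. z = c *\<^sub>R 1" if "z \<in> H 0" for z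
    using that by (auto simp: connected span_singleton)
  consider c where "x = c *\<^sub>R 1" | c where "y = c *\<^sub>R 1" | "i > 0" "j > 0"
    using scalar[of x] scalar[of y] x y by blast
  then show ?thesis
  proof cases
    case 3
    then show ?thesis
      using homogeneous_eq_0[OF \<delta> mult_graded[OF x y]] counit_graded[OF x] counit_graded[OF y]
      by simp
  qed (simp_all add: linear_scale[OF lin] linear_scale[OF counit_linear] \<delta>_1 counit_one)
qed

lemma homogeneous_1_infinitesimal_character:
  assumes \<delta>: "homogeneous H 1 \<delta>"
  shows "infinitesimal_character \<delta>"
  unfolding infinitesimal_character_def
proof (intro conjI allI)
  show lin: "linear \<delta>" using \<delta> by (rule homogeneous_imp_linear)
  have bilinear_left: "bilinear (\<lambda>x y. \<delta> (x * y))"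
    by (rule bilinear_compose_linear[OF bilinear_times lin])
  have bilinear_right: "bilinear (\<lambda>x y. \<epsilon> x * \<delta> y + \<delta> x * \<epsilon> y)"
    unfolding bilinear_def
    by (intro conjI allI linearI)
      (simp_all add: linear_add[OF lin] linear_scale[OF lin] linear_add[OF counit_linear]
        linear_scale[OF counit_linear] algebra_simps)
  show "\<delta> (x * y) = \<epsilon> x * \<delta> y + \<delta> x * \<epsilon> y" for x y
    by (rule bilinear_eq[OF bilinear_left bilinear_right order_refl order_refl
          in_span_graded[OF graded] in_span_graded[OF graded]])
      (auto intro: homogeneous_1_times[OF \<delta>])
qed

lemma conv_power_times_graded:
  assumes \<delta>: "homogeneous H 1 \<delta>" and x: "x \<in> H i" and y: "y \<in> H j"
  shows "conv_power \<delta> (i + j) (x * y)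
    = real (i + j choose i) * (conv_power \<delta> i x * conv_power \<delta> j y)"
proof -
  let ?term = "\<lambda>k. real (i + j choose k) * (conv_power \<delta> k x * conv_power \<delta> (i + j - k) y)"
  have "conv_power \<delta> (i + j) (x * y) = (\<Sum>k\<le>i + j. ?term k)"
    by (rule conv_power_times_binomial[OF homogeneous_1_infinitesimal_character[OF \<delta>]])
  also have "\<dots> = (\<Sum>k\<in>{i}. ?term k)"
    using homogeneous_eq_0[OF homogeneous_conv_power[OF \<delta>] x]
    by (intro sum.mono_neutral_right) auto
  finally show ?thesis by simp
qed

lemma prod_list_in_graded:
  "list_all2 (\<lambda>z e. z \<in> H e) zs E \<Longrightarrow> prod_list zs \<in> H (sum_list E)"
  by (induction rule: list_all2_induct) (simp_all add: one_in_graded mult_graded)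

lemma conv_power_prod_list:
  assumes \<delta>: "homogeneous H 1 \<delta>"
  shows "list_all2 (\<lambda>z e. z \<in> H e) zs E \<Longrightarrow>
    conv_power \<delta> (sum_list E) (prod_list zs) = multinomial E * prod_list (map2 (conv_power \<delta>) E zs)"
proof (induction rule: list_all2_induct)
  case Nil
  show ?case by (simp add: counit_one multinomial_def)
next
  case (Cons z zs e E)
  then show ?case
    using conv_power_times_graded[OF \<delta> Cons.hyps(1) prod_list_in_graded[OF Cons.hyps(2)]]
    by (simp add: multinomial_Cons)
qed

end

section \<open>Bases of tensor powers\<close>

lemma in_listset_iff: "xs \<in> listset As \<longleftrightarrow> list_all2 (\<in>) xs As"
  by (induction As arbitrary: xs) (auto simp: set_Cons_def list_all2_Cons2)

lemma finite_listset: "\<forall>A\<in>set As. finite A \<Longrightarrow> finite (listset As)"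
  by (induction As) (auto simp: set_Cons_def finite_image_set2)

lemma pure_tensor_in_span_listset:
  "list_all2 (\<lambda>x A. x \<in> span A) xs As \<Longrightarrow> pure_tensor xs \<in> span (pure_tensor ` listset As)"
proof (induction rule: list_all2_induct)
  case Nil
  show ?case by (simp add: span_base)
next
  case (Cons x xs A As)
  have "tensor_concat (tensor_of x) (pure_tensor xs) \<in> span (pure_tensor ` listset (A # As))"
  proof (rule linear_image_in_span[OF linear_tensor_concat_right Cons.IH])
    fix s assume "s \<in> pure_tensor ` listset As"
    then obtain zs where zs: "zs \<in> listset As" "s = pure_tensor zs" by auto
    show "tensor_concat (tensor_of x) s \<in> span (pure_tensor ` listset (A # As))"
    proof (rule linear_image_in_span[OF
          linear_compose[OF linear_tensor_of linear_tensor_concat_left], unfolded o_def])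
      show "x \<in> span A" by fact
      fix a assume "a \<in> A"
      with zs show "tensor_concat (tensor_of a) s \<in> span (pure_tensor ` listset (A # As))"
        by (intro span_base) (auto simp: tensor_of_def tensor_concat_pure set_Cons_def)
    qed
  qed
  then show ?case by (simp add: tensor_of_def tensor_concat_pure)
qed

context
  fixes S :: "'a::real_vector set"
  assumes S: "independent S" "span S = UNIV"
begin

lemma linear_representation: "linear (\<lambda>v. representation S v b)"
  by (rule linearI) (simp_all add: representation_add representation_scale S)

lemma tensor_eval_representation:
  assumes "xs \<in> lists S" "zs \<in> lists S"
  shows "tensor_eval (map (\<lambda>b v. representation S v b) zs) (pure_tensor xs)
    = (if xs = zs then 1 else 0)"
proof -
  let ?coords = "map (\<lambda>b v. representation S v b) zs"
  have lin: "\<forall>f\<in>set ?coords. linear f"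
    using linear_representation by auto
  have "prod_list (map_apply ?coords xs) = (if xs = zs then 1 else 0)"
    if "length xs = length zs"
    using that assms
    by (induction rule: list_induct2) (simp_all add: representation_basis[OF S(1)])
  then show ?thesis
    unfolding tensor_eval_pure[OF lin] length_map by (metis (no_types))
qed

lemma inj_on_pure_tensor: "inj_on pure_tensor (lists S)"
proof (rule inj_onI)
  fix xs ys assume "xs \<in> lists S" "ys \<in> lists S" "pure_tensor xs = pure_tensor ys"
  then show "xs = ys"
    using tensor_eval_representation[of xs xs] tensor_eval_representation[of ys xs]
    by (metis zero_neq_one)
qed

lemma independent_pure_tensor:
  assumes "L \<subseteq> lists S"
  shows "independent (pure_tensor ` L)"
  unfolding dependent_def
proof (intro notI, elim bexE)
  fix t assume t: "t \<in> pure_tensor ` L" "t \<in> span (pure_tensor ` L - {t})"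
  then obtain zs where zs: "t = pure_tensor zs" "zs \<in> L" by auto
  let ?coord = "tensor_eval (map (\<lambda>b v. representation S v b) zs)"
  have "linear ?coord"
    using linear_representation by (intro linear_tensor_eval) auto
  moreover have "?coord s = 0" if "s \<in> pure_tensor ` L - {t}" for s
  proof -
    from that zs obtain xs where "s = pure_tensor xs" "xs \<in> L" "xs \<noteq> zs" by auto
    then show ?thesis
      using tensor_eval_representation[of xs zs] zs assms by auto
  qed
  ultimately have "?coord t = 0"
    using t(2) by (rule linear_eq_0_on_span)
  moreover have "?coord t = 1"
    using tensor_eval_representation[of zs zs] zs assms by auto
  ultimately show False by simp
qed

end

section \<open>The function \<open>\<eta>\<close>\<close>

locale based_hopf_algebra = graded_connected_hopf_algebra H \<Delta> \<epsilon> + graded_basis H B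
  for H :: "nat \<Rightarrow> 'h::real_algebra_1 set" and \<Delta> \<epsilon> B +
  assumes finite_basis: "finite (B k)"
    and basis_0: "B 0 = {1}"
begin

abbreviation \<eta> :: "nat \<Rightarrow> 'h \<Rightarrow> real" where
  "\<eta> \<equiv> eta H \<Delta> \<epsilon> B"

abbreviation \<eta>_prod :: "nat list \<Rightarrow> 'h list \<Rightarrow> real" where
  "\<eta>_prod \<equiv> eta_prod H \<Delta> \<epsilon> B"

abbreviation basis_lists :: "nat list \<Rightarrow> 'h list set" where
  "basis_lists E \<equiv> listset (map B E)"

abbreviation coprod_coeff :: "nat list \<Rightarrow> 'h \<Rightarrow> 'h list \<Rightarrow> real" where
  "coprod_coeff \<equiv> comult_coeff H \<Delta> \<epsilon> B"

lemma finite_basis_lists: "finite (basis_lists E)"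
  by (rule finite_listset) (simp add: finite_basis)

lemma basis_lists_subset: "basis_lists E \<subseteq> lists (\<Union>n. B n)"
  by (fastforce simp: in_listset_iff list_all2_conv_all_nth in_set_conv_nth in_lists_conv_set)

lemma length_basis_lists: "zs \<in> basis_lists E \<Longrightarrow> length zs = length E"
  by (auto simp: in_listset_iff dest: list_all2_lengthD)

lemma basis_lists_graded: "zs \<in> basis_lists E \<Longrightarrow> list_all2 (\<lambda>z e. z \<in> H e) zs E"
  by (auto simp: in_listset_iff list_all2_conv_all_nth basis_in_graded)

lemma coprod_comp_eq_tensor_map:
  "coprod_comp H \<Delta> \<epsilon> E x
    = tensor_map (map (graded_proj H) E) (iterated_coprod \<Delta> \<epsilon> (length E) x)"
  by (simp add: coprod_comp_def tensor_map_def o_def)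

lemma linear_graded_projs: "\<forall>f\<in>set (map (graded_proj H) E). linear f"
  by (simp add: linear_graded_proj[OF graded_H])

lemma coprod_comp_in_span: "coprod_comp H \<Delta> \<epsilon> E x \<in> span (pure_tensor ` basis_lists E)"
  unfolding coprod_comp_eq_tensor_map
proof (rule linear_image_in_span[OF linear_tensor_map[OF linear_graded_projs] tensor_in_span_pure])
  fix s :: "'h tensor" assume "s \<in> range pure_tensor"
  then obtain xs where s: "s = pure_tensor xs" by auto
  have "pure_tensor (map_apply (map (graded_proj H) E) xs) \<in> span (pure_tensor ` basis_lists E)"
    if "length xs = length E"
    by (rule pure_tensor_in_span_listset)
      (use that in \<open>simp add: list_all2_conv_all_nth span_basis graded_proj_in[OF graded_H]\<close>)
  then show "tensor_map (map (graded_proj H) E) s \<in> span (pure_tensor ` basis_lists E)"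
    unfolding s tensor_map_pure[OF linear_graded_projs] by (simp add: span_zero)
qed

lemma coprod_comp_expand:
  "coprod_comp H \<Delta> \<epsilon> E x = (\<Sum>zs\<in>basis_lists E. coprod_coeff E x zs *\<^sub>R pure_tensor zs)"
proof -
  note total_basis = independent_Union_basis span_Union_basis
  have "coprod_comp H \<Delta> \<epsilon> E x = (\<Sum>t\<in>pure_tensor ` basis_lists E.
      representation (pure_tensor ` basis_lists E) (coprod_comp H \<Delta> \<epsilon> E x) t *\<^sub>R t)"
    using independent_pure_tensor[OF total_basis basis_lists_subset] coprod_comp_in_span
    by (intro sum_representation_eq[symmetric]) (auto simp: finite_basis_lists)
  also have "\<dots> = (\<Sum>zs\<in>basis_lists E. coprod_coeff E x zs *\<^sub>R pure_tensor zs)"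
    using inj_on_subset[OF inj_on_pure_tensor[OF total_basis] basis_lists_subset]
    by (simp add: sum.reindex comult_coeff_def)
  finally show ?thesis .
qed

lemma tensor_eval_coprod_comp:
  assumes fs: "\<forall>f\<in>set fs. linear f" and "length fs = length E"
  shows "tensor_eval fs (coprod_comp H \<Delta> \<epsilon> E x)
    = (\<Sum>zs\<in>basis_lists E. coprod_coeff E x zs *\<^sub>R prod_list (map_apply fs zs))"
  unfolding coprod_comp_expand
  by (simp add: linear_sum[OF linear_tensor_eval[OF fs]] linear_scale[OF linear_tensor_eval[OF fs]]
      tensor_eval_pure[OF fs] length_basis_lists assms(2))

definition \<zeta> :: "'h \<Rightarrow> real" where
  "\<zeta> = construct (\<Union>n. B n) (indicator (B 1))"

lemma linear_zeta: "linear \<zeta>"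
  unfolding \<zeta>_def by (rule linear_construct[OF independent_Union_basis])

lemma zeta_basis: "b \<in> B k \<Longrightarrow> \<zeta> b = (if k = 1 then 1 else 0)"
  unfolding \<zeta>_def using basis_degree_unique
  by (subst construct_basis[OF independent_Union_basis]) (auto simp: indicator_def)

lemma homogeneous_zeta: "homogeneous H 1 \<zeta>"
  using linear_eq_0_on_span[OF linear_zeta, of "B _"]
  by (auto simp: homogeneous_def linear_zeta zeta_basis span_basis)

lemma homogeneous_zeta_power: "homogeneous H k (conv_power \<zeta> k)"
  using homogeneous_conv_power[OF homogeneous_zeta] by simp

lemma sum_coprod_coeff_zeta_power:
  "(\<Sum>zs\<in>basis_lists E. coprod_coeff E x zs * prod_list (map2 (conv_power \<zeta>) E zs))
     = conv_power \<zeta> (sum_list E) x"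
proof -
  let ?\<zeta>s = "map (conv_power \<zeta>) E"
  have lin: "\<forall>\<phi>\<in>set ?\<zeta>s. linear \<phi>" by (simp add: linear_conv_power linear_zeta)
  have "map_apply ?\<zeta>s zs = map2 (conv_power \<zeta>) E zs" for zs
    by (simp add: list_eq_iff_nth_eq)
  then have "(\<Sum>zs\<in>basis_lists E. coprod_coeff E x zs * prod_list (map2 (conv_power \<zeta>) E zs))
      = tensor_eval ?\<zeta>s (coprod_comp H \<Delta> \<epsilon> E x)"
    by (simp only: tensor_eval_coprod_comp[OF lin] length_map real_scaleR_def)
  also have "\<dots> = tensor_eval (map2 (\<circ>) ?\<zeta>s (map (graded_proj H) E))
      (iterated_coprod \<Delta> \<epsilon> (length E) x)"
    unfolding coprod_comp_eq_tensor_map by (rule tensor_eval_map[OF linear_graded_projs lin]) simp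
  also have "map2 (\<circ>) ?\<zeta>s (map (graded_proj H) E) = ?\<zeta>s"
    by (simp add: list_eq_iff_nth_eq
        homogeneous_comp_graded_proj[OF graded_H homogeneous_zeta_power])
  also have "tensor_eval ?\<zeta>s (iterated_coprod \<Delta> \<epsilon> (length E) x) = foldr conv ?\<zeta>s \<epsilon> x"
    using fun_cong[OF tensor_eval_iterated_coprod[OF lin], of x] by simp
  also have "\<dots> = conv_power \<zeta> (sum_list E) x"
    by (simp add: foldr_conv_power linear_zeta)
  finally show ?thesis .
qed

lemma eta_eq_zeta_power:
  assumes "x \<in> B j"
  shows "\<eta> j x = conv_power \<zeta> j x"
proof (cases "j = 0")
  case True
  with assms basis_0 show ?thesis by (simp add: eta_def counit_one)
next
  case False
  have prod_1: "prod_list (map2 (conv_power \<zeta>) (replicate j 1) zs) = 1"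
    if "zs \<in> basis_lists (replicate j 1)" for zs
    using that
    by (induction j arbitrary: zs) (auto simp: set_Cons_def conv_power_1 linear_zeta zeta_basis)
  have "\<eta> j x = (\<Sum>zs\<in>basis_lists (replicate j 1).
      coprod_coeff (replicate j 1) x zs * prod_list (map2 (conv_power \<zeta>) (replicate j 1) zs))"
    using False by (simp only: eta_def prod_1 map_replicate mult_1_right if_False cong: sum.cong)
  also have "\<dots> = conv_power \<zeta> j x"
    by (subst sum_coprod_coeff_zeta_power) (simp add: sum_list_replicate)
  finally show ?thesis .
qed

lemma eta_prod_eq_zeta_power:
  "zs \<in> basis_lists E \<Longrightarrow> \<eta>_prod E zs = prod_list (map2 (conv_power \<zeta>) E zs)"
  by (induction E arbitrary: zs) (auto simp: eta_prod_def set_Cons_def eta_eq_zeta_power)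

lemma sum_coprod_coeff_eta_prod:
  assumes "x \<in> B (sum_list E)"
  shows "(\<Sum>zs\<in>basis_lists E. coprod_coeff E x zs * \<eta>_prod E zs) = \<eta> (sum_list E) x"
  using sum_coprod_coeff_zeta_power[of E x]
  by (simp add: eta_prod_eq_zeta_power eta_eq_zeta_power[OF assms])

lemma sum_mult_coeff_eta:
  assumes zs: "zs \<in> basis_lists E"
  shows "(\<Sum>y\<in>B (sum_list E). mult_coeff B (sum_list E) zs y * \<eta> (sum_list E) y)
    = multinomial E * \<eta>_prod E zs"
proof -
  let ?n = "sum_list E"
  have lin: "linear (conv_power \<zeta> ?n)"
    by (rule linear_conv_power[OF linear_zeta])
  have "prod_list zs \<in> span (B ?n)"
    unfolding span_basis using basis_lists_graded[OF zs] by (rule prod_list_in_graded)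
  then have "conv_power \<zeta> ?n (prod_list zs)
      = conv_power \<zeta> ?n (\<Sum>y\<in>B ?n. mult_coeff B ?n zs y *\<^sub>R y)"
    by (simp add: mult_coeff_def sum_representation_eq independent_basis finite_basis)
  also have "\<dots> = (\<Sum>y\<in>B ?n. mult_coeff B ?n zs y * \<eta> ?n y)"
    by (simp add: linear_sum[OF lin] linear_scale[OF lin] eta_eq_zeta_power)
  finally show ?thesis
    using conv_power_prod_list[OF homogeneous_zeta basis_lists_graded[OF zs]]
    by (simp add: eta_prod_eq_zeta_power[OF zs])
qed

lemma eta_coalgebra_ambimorphism:
  assumes \<tau>: "\<And>k b. b \<in> B k \<Longrightarrow> \<tau> b \<in> B k"
    and ambi: "coalgebra_morphism \<Delta> \<epsilon> (linear_ext B \<tau>) \<or>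
               coalgebra_antimorphism \<Delta> \<epsilon> (linear_ext B \<tau>)"
    and b: "b \<in> B k"
  shows "\<eta> k (\<tau> b) = \<eta> k b"
proof -
  have "\<zeta> \<circ> linear_ext B \<tau> = \<zeta>"
    using linear_compose[OF linear_linear_ext linear_zeta] linear_zeta
    by (rule linear_eq_on_basis) (auto simp: linear_ext_basis zeta_basis dest: \<tau>)
  then have "conv_power \<zeta> k (linear_ext B \<tau> b) = conv_power \<zeta> k b"
    using fun_cong[OF conv_power_comp_ambimorphism[OF ambi linear_zeta], of k b] by simp
  then show ?thesis
    using b \<tau>[OF b] by (simp add: linear_ext_basis eta_eq_zeta_power)
qed

lemma mult_comult_eq_sum:
  "mult_comult H \<Delta> \<epsilon> (linear_ext B \<tau>) D x = (\<Sum>zs\<in>basis_lists (forget D).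
     coprod_coeff (forget D) x zs *\<^sub>R prod_list (apply_decorations \<tau> D zs))"
proof -
  let ?fs = "decorated_maps (linear_ext B \<tau>) D"
  have lin: "\<forall>f\<in>set ?fs. linear f"
    by (auto simp: decorated_maps_def linear_linear_ext linear_id)
  have "map_apply ?fs zs = apply_decorations \<tau> D zs" if "zs \<in> basis_lists (forget D)" for zs
    using that by (induction D arbitrary: zs)
      (auto simp: apply_decorations_def decorated_maps_def set_Cons_def linear_ext_basis)
  moreover have "mult_comult H \<Delta> \<epsilon> (linear_ext B \<tau>) D x
      = tensor_eval ?fs (coprod_comp H \<Delta> \<epsilon> (forget D) x)"
    by (simp add: mult_comult_def tensor_eval_def tensor_map_def)
  ultimately show ?thesis
    using tensor_eval_coprod_comp[OF lin, of "forget D" x] by (simp add: decorated_maps_def)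
qed

end

section \<open>Splitting and merging\<close>

lemma pmf_embed_pmf_finite:
  assumes "finite A" "\<And>x. 0 \<le> f x" "\<And>x. x \<notin> A \<Longrightarrow> f x = 0" "sum f A = 1"
  shows "pmf (embed_pmf f) x = f x"
proof (rule pmf_embed_pmf[OF assms(2)])
  have "(\<integral>\<^sup>+x. ennreal (f x) \<partial>count_space UNIV) = (\<Sum>x\<in>A. ennreal (f x))"
    using assms(1,3) by (intro nn_integral_count_space') auto
  also have "\<dots> = 1"
    using assms by (simp add: sum_ennreal)
  finally show "(\<integral>\<^sup>+x. ennreal (f x) \<partial>count_space UNIV) = 1" .
qed

lemma pmf_bind_eq_infsum: "pmf (bind_pmf p f) y = (\<Sum>\<^sub>\<infinity>x. pmf p x * pmf (f x) y)"
proof -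
  have "Infinite_Set_Sum.abs_summable_on (\<lambda>x. pmf p x * pmf (f x) y) UNIV"
    by (rule abs_summable_on_comparison_test'[OF pmf_abs_summable[of p]])
      (simp add: mult_left_le pmf_le_1)
  then show ?thesis
    by (simp add: pmf_bind pmf_expectation_eq_infsetsum infsetsum_infsum)
qed

lemma apply_decorations_in_listset:
  assumes "\<And>k b. b \<in> B k \<Longrightarrow> \<tau> b \<in> B k" and "zs \<in> listset (map B (forget D))"
  shows "apply_decorations \<tau> D zs \<in> listset (map B (forget D))"
  using assms(2)
  by (induction D arbitrary: zs)
    (auto simp: apply_decorations_def decorated_maps_def set_Cons_def assms(1))

context based_hopf_algebra
begin

lemma eta_prod_apply_decorations:
  assumes "\<And>k b. b \<in> B k \<Longrightarrow> \<eta> k (\<tau> b) = \<eta> k b" and "zs \<in> basis_lists (forget D)"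
  shows "\<eta>_prod (forget D) (apply_decorations \<tau> D zs) = \<eta>_prod (forget D) zs"
  using assms(2)
  by (induction D arbitrary: zs)
    (auto simp: eta_prod_def apply_decorations_def decorated_maps_def set_Cons_def assms(1))

definition split_merge_pmf ::
    "('h \<Rightarrow> 'h) \<Rightarrow> nat \<Rightarrow> decorated_composition \<Rightarrow> 'h \<Rightarrow> 'h pmf" where
  "split_merge_pmf \<tau> n D x =
     bind_pmf (embed_pmf (split_prob H \<Delta> \<epsilon> B n D x)) (\<lambda>zs. embed_pmf (merge_prob H \<Delta> \<epsilon> B \<tau> n D zs))"

lemma hopf_process_eq_bind:
  "hopf_process H \<Delta> \<epsilon> B \<tau> n P x = bind_pmf P (\<lambda>D. split_merge_pmf \<tau> n D x)"
  by (simp add: hopf_process_def split_merge_pmf_def)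

end

locale descent_step = based_hopf_algebra H \<Delta> \<epsilon> B
  for H :: "nat \<Rightarrow> 'h::real_algebra_1 set" and \<Delta> \<epsilon> B +
  fixes \<tau> :: "'h \<Rightarrow> 'h" and n :: nat and D :: decorated_composition
  assumes \<tau>_basis: "b \<in> B k \<Longrightarrow> \<tau> b \<in> B k"
    and \<tau>_coalgebra: "coalgebra_morphism \<Delta> \<epsilon> (linear_ext B \<tau>) \<or>
                      coalgebra_antimorphism \<Delta> \<epsilon> (linear_ext B \<tau>)"
    and sum_parts: "sum_list (forget D) = n"
    and mult_nonneg: "zs \<in> basis_lists (forget D) \<Longrightarrow> y \<in> B n \<Longrightarrow> mult_coeff B n zs y \<ge> 0"
    and comult_nonneg: "x \<in> B n \<Longrightarrow> zs \<in> basis_lists (forget D) \<Longrightarrow>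
                        coprod_coeff (forget D) x zs \<ge> 0"
    and eta_pos: "x \<in> B n \<Longrightarrow> \<eta> n x > 0"
begin

abbreviation parts :: "nat list" where
  "parts \<equiv> forget D"

abbreviation merge_coeff :: "'h list \<Rightarrow> 'h \<Rightarrow> real" where
  "merge_coeff zs y \<equiv> mult_coeff B n (apply_decorations \<tau> D zs) y"

abbreviation split_mass :: "'h \<Rightarrow> 'h list \<Rightarrow> real" where
  "split_mass \<equiv> split_prob H \<Delta> \<epsilon> B n D"

abbreviation merge_mass :: "'h list \<Rightarrow> 'h \<Rightarrow> real" where
  "merge_mass \<equiv> merge_prob H \<Delta> \<epsilon> B \<tau> n D"

lemma apply_decorations_in_basis_lists:
  "zs \<in> basis_lists parts \<Longrightarrow> apply_decorations \<tau> D zs \<in> basis_lists parts"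
  by (rule apply_decorations_in_listset[OF \<tau>_basis])

lemma merge_coeff_nonneg: "zs \<in> basis_lists parts \<Longrightarrow> y \<in> B n \<Longrightarrow> merge_coeff zs y \<ge> 0"
  by (rule mult_nonneg[OF apply_decorations_in_basis_lists])

lemma sum_merge_coeff_eta:
  assumes zs: "zs \<in> basis_lists parts"
  shows "(\<Sum>y\<in>B n. merge_coeff zs y * \<eta> n y) = multinomial parts * \<eta>_prod parts zs"
  using sum_mult_coeff_eta[OF apply_decorations_in_basis_lists[OF zs]]
    eta_prod_apply_decorations[OF eta_coalgebra_ambimorphism[OF \<tau>_basis \<tau>_coalgebra] zs]
  by (simp add: sum_parts)

lemma eta_prod_nonneg:
  assumes zs: "zs \<in> basis_lists parts"
  shows "\<eta>_prod parts zs \<ge> 0"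
proof -
  have "(\<Sum>y\<in>B n. merge_coeff zs y * \<eta> n y) \<ge> 0"
    by (intro sum_nonneg mult_nonneg_nonneg merge_coeff_nonneg zs less_imp_le[OF eta_pos])
  then show ?thesis
    using multinomial_pos[of parts] by (simp add: sum_merge_coeff_eta[OF zs] zero_le_mult_iff)
qed

lemma merge_coeff_eq_0:
  assumes zs: "zs \<in> basis_lists parts" and y: "y \<in> B n" and "\<eta>_prod parts zs = 0"
  shows "merge_coeff zs y = 0"
proof -
  have "(\<Sum>y\<in>B n. merge_coeff zs y * \<eta> n y) = 0"
    by (simp add: sum_merge_coeff_eta[OF zs] assms(3))
  moreover have "merge_coeff zs y * \<eta> n y \<ge> 0" if "y \<in> B n" for y
    by (intro mult_nonneg_nonneg merge_coeff_nonneg zs less_imp_le[OF eta_pos] that)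
  ultimately have "merge_coeff zs y * \<eta> n y = 0"
    using y by (simp add: sum_nonneg_eq_0_iff finite_basis)
  then show ?thesis using eta_pos[OF y] by simp
qed

lemma split_prob_nonneg: "x \<in> B n \<Longrightarrow> split_mass x zs \<ge> 0"
  using eta_pos[of x] by (simp add: split_prob_def comult_nonneg eta_prod_nonneg)

lemma sum_split_prob:
  assumes x: "x \<in> B n"
  shows "(\<Sum>zs\<in>basis_lists parts. split_mass x zs) = 1"
proof -
  have "(\<Sum>zs\<in>basis_lists parts. split_mass x zs)
      = 1 / \<eta> n x * (\<Sum>zs\<in>basis_lists parts. coprod_coeff parts x zs * \<eta>_prod parts zs)"
    by (simp add: split_prob_def sum_distrib_left mult.assoc)
  then show ?thesis
    using sum_coprod_coeff_eta_prod[of x parts] eta_pos[OF x] x by (simp add: sum_parts)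
qed

lemma split_prob_nonzero:
  assumes "split_mass x zs \<noteq> 0"
  shows "zs \<in> basis_lists parts" "\<eta>_prod parts zs > 0"
proof -
  show zs: "zs \<in> basis_lists parts"
    using assms by (simp add: split_prob_def split: if_splits)
  show "\<eta>_prod parts zs > 0"
    using assms eta_prod_nonneg[OF zs] by (simp add: split_prob_def less_le split: if_splits)
qed

lemma pmf_embed_split_prob: "x \<in> B n \<Longrightarrow> pmf (embed_pmf (split_mass x)) zs = split_mass x zs"
  by (rule pmf_embed_pmf_finite[OF finite_basis_lists split_prob_nonneg _ sum_split_prob])
    (simp_all add: split_prob_def)

lemma merge_prob_nonneg:
  assumes "zs \<in> basis_lists parts" "\<eta>_prod parts zs > 0"
  shows "merge_mass zs y \<ge> 0"
  using assms multinomial_pos[of parts]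
  by (simp add: merge_prob_def merge_coeff_nonneg less_imp_le eta_pos)

lemma sum_merge_prob:
  assumes zs: "zs \<in> basis_lists parts" and pos: "\<eta>_prod parts zs > 0"
  shows "(\<Sum>y\<in>B n. merge_mass zs y) = 1"
proof -
  have "(\<Sum>y\<in>B n. merge_mass zs y)
      = inverse (multinomial parts * \<eta>_prod parts zs) * (\<Sum>y\<in>B n. merge_coeff zs y * \<eta> n y)"
    by (simp add: merge_prob_def sum_distrib_left mult.assoc)
  also have "\<dots> = 1"
    unfolding sum_merge_coeff_eta[OF zs] using multinomial_pos[of parts] pos
    by (intro left_inverse) simp
  finally show ?thesis .
qed

lemma pmf_embed_merge_prob:
  assumes "zs \<in> basis_lists parts" "\<eta>_prod parts zs > 0"
  shows "pmf (embed_pmf (merge_mass zs)) y = merge_mass zs y"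
  by (rule pmf_embed_pmf_finite[OF finite_basis merge_prob_nonneg[OF assms] _
        sum_merge_prob[OF assms]]) (simp add: merge_prob_def)

lemma split_times_merge:
  assumes x: "x \<in> B n" and y: "y \<in> B n" and zs: "zs \<in> basis_lists parts"
  shows "split_mass x zs * pmf (embed_pmf (merge_mass zs)) y
    = \<eta> n y / \<eta> n x / multinomial parts * (coprod_coeff parts x zs * merge_coeff zs y)"
proof (cases "split_mass x zs = 0")
  case True
  then have "coprod_coeff parts x zs = 0 \<or> \<eta>_prod parts zs = 0"
    using zs eta_pos[OF x] by (simp add: split_prob_def)
  then show ?thesis
    using True merge_coeff_eq_0[OF zs y] by auto
next
  case False
  note pos = split_prob_nonzero(2)[OF False]
  then show ?thesis
    using zs y
    by (simp add: pmf_embed_merge_prob[OF zs pos] split_prob_def merge_prob_def field_simps)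
qed

lemma representation_mult_comult:
  "representation (B n) (mult_comult H \<Delta> \<epsilon> (linear_ext B \<tau>) D x) y
    = (\<Sum>zs\<in>basis_lists parts. coprod_coeff parts x zs * merge_coeff zs y)"
proof -
  have span: "prod_list (apply_decorations \<tau> D zs) \<in> span (B n)" if "zs \<in> basis_lists parts" for zs
    using prod_list_in_graded[OF basis_lists_graded[OF apply_decorations_in_basis_lists[OF that]]]
    by (simp add: sum_parts span_basis)
  have "representation (B n) (mult_comult H \<Delta> \<epsilon> (linear_ext B \<tau>) D x) y
      = (\<Sum>zs\<in>basis_lists parts. representation (B n)
          (coprod_coeff parts x zs *\<^sub>R prod_list (apply_decorations \<tau> D zs)) y)"
    by (simp only: mult_comult_eq_sum representation_sum[OF independent_basis span_scale[OF span]])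
  also have "\<dots> = (\<Sum>zs\<in>basis_lists parts. coprod_coeff parts x zs * merge_coeff zs y)"
    by (rule sum.cong)
      (simp_all add: representation_scale[OF independent_basis span] mult_coeff_def)
  finally show ?thesis .
qed

lemma pmf_split_merge_pmf:
  assumes x: "x \<in> B n" and y: "y \<in> B n"
  shows "pmf (split_merge_pmf \<tau> n D x) y = \<eta> n y / \<eta> n x *
    (representation (B n) (mult_comult H \<Delta> \<epsilon> (linear_ext B \<tau>) D x) y / multinomial parts)"
proof -
  have support: "zs \<in> basis_lists parts" if "zs \<in> set_pmf (embed_pmf (split_mass x))" for zs
    by (rule split_prob_nonzero)
      (use that in \<open>simp add: set_pmf_iff pmf_embed_split_prob[OF x]\<close>)
  have "pmf (split_merge_pmf \<tau> n D x) y
      = (\<Sum>zs\<in>basis_lists parts. split_mass x zs * pmf (embed_pmf (merge_mass zs)) y)"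
    unfolding split_merge_pmf_def pmf_bind
    by (simp only: integral_measure_pmf[OF finite_basis_lists support] pmf_embed_split_prob[OF x]
        real_scaleR_def)
  also have "\<dots> = \<eta> n y / \<eta> n x / multinomial parts *
      (\<Sum>zs\<in>basis_lists parts. coprod_coeff parts x zs * merge_coeff zs y)"
    unfolding sum_distrib_left by (rule sum.cong) (simp_all add: split_times_merge[OF x y])
  finally show ?thesis
    by (simp add: representation_mult_comult)
qed

lemma set_split_merge_pmf:
  assumes x: "x \<in> B n"
  shows "set_pmf (split_merge_pmf \<tau> n D x) \<subseteq> B n"
proof
  fix y assume "y \<in> set_pmf (split_merge_pmf \<tau> n D x)"
  then obtain zs where zs: "split_mass x zs \<noteq> 0" and y: "pmf (embed_pmf (merge_mass zs)) y \<noteq> 0"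
    by (auto simp: split_merge_pmf_def set_pmf_iff pmf_embed_split_prob[OF x])
  then show "y \<in> B n"
    by (simp add: pmf_embed_merge_prob[OF split_prob_nonzero[OF zs]] merge_prob_def
        split: if_splits)
qed

end

locale descent_chain = based_hopf_algebra H \<Delta> \<epsilon> B
  for H :: "nat \<Rightarrow> 'h::real_algebra_1 set" and \<Delta> \<epsilon> B +
  fixes \<tau> :: "'h \<Rightarrow> 'h" and n :: nat and P :: "decorated_composition pmf"
  assumes descent_step_support: "D \<in> set_pmf P \<Longrightarrow> descent_step H \<Delta> \<epsilon> B \<tau> n D"
begin

lemma transition_eq_pmf_hopf_process:
  assumes x: "x \<in> B n" and y: "y \<in> B n"
  shows "transition H \<Delta> \<epsilon> B \<tau> n P x y = pmf (hopf_process H \<Delta> \<epsilon> B \<tau> n P x) y"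
proof -
  let ?coeff = "\<lambda>D. representation (B n) (mult_comult H \<Delta> \<epsilon> (linear_ext B \<tau>) D x) y"
  have "transition H \<Delta> \<epsilon> B \<tau> n P x y
      = \<eta> n y / \<eta> n x * (\<Sum>\<^sub>\<infinity>D. pmf P D / multinomial (forget D) * ?coeff D)"
    by (simp add: transition_def mult_comult_dist_def
        representation_sum_scaleR[OF independent_basis finite_basis y])
  also have "\<dots> = (\<Sum>\<^sub>\<infinity>D. \<eta> n y / \<eta> n x * (pmf P D / multinomial (forget D) * ?coeff D))"
    by (rule infsum_cmult_right'[symmetric])
  also have "\<dots> = (\<Sum>\<^sub>\<infinity>D. pmf P D * pmf (split_merge_pmf \<tau> n D x) y)"
  proof (rule infsum_cong)
    fix D
    show "\<eta> n y / \<eta> n x * (pmf P D / multinomial (forget D) * ?coeff D)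
        = pmf P D * pmf (split_merge_pmf \<tau> n D x) y"
      using descent_step.pmf_split_merge_pmf[OF descent_step_support x y, of D]
      by (cases "D \<in> set_pmf P") (simp_all add: set_pmf_iff)
  qed
  finally show ?thesis by (simp add: hopf_process_eq_bind pmf_bind_eq_infsum)
qed

lemma transition_nonneg: "x \<in> B n \<Longrightarrow> y \<in> B n \<Longrightarrow> transition H \<Delta> \<epsilon> B \<tau> n P x y \<ge> 0"
  by (simp add: transition_eq_pmf_hopf_process)

lemma sum_transition:
  assumes x: "x \<in> B n"
  shows "(\<Sum>y\<in>B n. transition H \<Delta> \<epsilon> B \<tau> n P x y) = 1"
proof -
  have "set_pmf (hopf_process H \<Delta> \<epsilon> B \<tau> n P x) \<subseteq> B n"
    using descent_step.set_split_merge_pmf[OF descent_step_support x]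
    by (auto simp: hopf_process_eq_bind)
  then show ?thesis
    using sum_pmf_eq_1[OF finite_basis] by (simp add: transition_eq_pmf_hopf_process[OF x])
qed

end

theorem theorem4p2:
  fixes H :: "nat \<Rightarrow> 'h::real_algebra_1 set"
    and \<Delta> :: "'h \<Rightarrow> 'h tensor"
    and \<epsilon> :: "'h \<Rightarrow> real"
    and B :: "nat \<Rightarrow> 'h set"
    and \<tau> :: "'h \<Rightarrow> 'h"
    and n :: nat
    and P :: "decorated_composition pmf"
  assumes hopf: "graded_connected_hopf_algebra H \<Delta> \<epsilon>"
    and basis: "\<And>k. finite (B k) \<and> independent (B k) \<and> span (B k) = H k"
    and basis_0: "B 0 = {1}"
    and involution: "\<And>k b. b \<in> B k \<Longrightarrow> \<tau> b \<in> B k \<and> \<tau> (\<tau> b) = b"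
    and ambimorphism: "hopf_ambimorphism \<Delta> \<epsilon> (linear_ext B \<tau>)"
    and distribution: "set_pmf P \<subseteq> signed_weak_compositions n \<or>
                       set_pmf P \<subseteq> tilde_signed_weak_compositions n"
    and mult_nonneg: "\<And>D zs y. pmf P D > 0 \<Longrightarrow> zs \<in> listset (map B (forget D)) \<Longrightarrow> y \<in> B n \<Longrightarrow>
                       mult_coeff B n zs y \<ge> 0"
    and comult_nonneg: "\<And>D x zs. pmf P D > 0 \<Longrightarrow> x \<in> B n \<Longrightarrow> zs \<in> listset (map B (forget D)) \<Longrightarrow>
                       comult_coeff H \<Delta> \<epsilon> B (forget D) x zs \<ge> 0"
    and eta_pos: "\<And>x. x \<in> B n \<Longrightarrow> eta H \<Delta> \<epsilon> B n x > 0"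
  shows "(\<forall>x\<in>B n. \<forall>y\<in>B n. transition H \<Delta> \<epsilon> B \<tau> n P x y \<ge> 0) \<and>
    (\<forall>x\<in>B n. (\<Sum>y\<in>B n. transition H \<Delta> \<epsilon> B \<tau> n P x y) = 1) \<and>
    (\<forall>x\<in>B n. \<forall>D. pmf P D > 0 \<longrightarrow>
       (\<forall>zs. split_prob H \<Delta> \<epsilon> B n D x zs \<ge> 0) \<and>
       (\<Sum>zs\<in>listset (map B (forget D)). split_prob H \<Delta> \<epsilon> B n D x zs) = 1 \<and>
       (\<forall>zs. split_prob H \<Delta> \<epsilon> B n D x zs > 0 \<longrightarrow>
          (\<forall>y. merge_prob H \<Delta> \<epsilon> B \<tau> n D zs y \<ge> 0) \<and>
          (\<Sum>y\<in>B n. merge_prob H \<Delta> \<epsilon> B \<tau> n D zs y) = 1)) \<and>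
    (\<forall>x\<in>B n. \<forall>y\<in>B n.
       transition H \<Delta> \<epsilon> B \<tau> n P x y = pmf (hopf_process H \<Delta> \<epsilon> B \<tau> n P x) y)"
proof -
  have based: "based_hopf_algebra H \<Delta> \<epsilon> B"
    using hopf basis basis_0 graded_connected_hopf_algebra.graded[OF hopf]
    by (simp add: based_hopf_algebra_def graded_basis_def based_hopf_algebra_axioms_def)
  interpret descent_chain H \<Delta> \<epsilon> B \<tau> n P
  proof (intro descent_chain.intro descent_chain_axioms.intro based)
    fix D assume "D \<in> set_pmf P"
    then show "descent_step H \<Delta> \<epsilon> B \<tau> n D"
      using based involution ambimorphism distribution mult_nonneg comult_nonneg eta_pos
      by (auto simp: descent_step_def descent_step_axioms_def hopf_ambimorphism_def pmf_positive_iff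
          signed_weak_compositions_def tilde_signed_weak_compositions_def)
  qed
  show ?thesis
  proof (intro conjI ballI allI impI)
    fix x D assume x: "x \<in> B n" and "pmf P D > 0"
    then interpret descent_step H \<Delta> \<epsilon> B \<tau> n D
      by (intro descent_step_support) (simp add: pmf_positive_iff)
    show "split_mass x zs \<ge> 0" for zs by (rule split_prob_nonneg[OF x])
    show "sum (split_mass x) (basis_lists parts) = 1" by (rule sum_split_prob[OF x])
    fix zs assume "split_mass x zs > 0"
    then have zs: "zs \<in> basis_lists parts" "\<eta>_prod parts zs > 0"
      using split_prob_nonzero[of x zs] by simp_all
    show "merge_mass zs y \<ge> 0" for y by (rule merge_prob_nonneg[OF zs])
    show "sum (merge_mass zs) (B n) = 1" by (rule sum_merge_prob[OF zs])
  qed (rule transition_nonneg sum_transition transition_eq_pmf_hopf_process; assumption)+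
qed

end
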